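(* Let $\theta\in(0,1)$ and let $(\mathcal{T}_n)_{n\ge1}$ be the recursive trees with limited memory in the macroscopic regime, $j(n)=\lfloor\theta n\rfloor$. Let $H_n$ be the height of $\mathcal{T}_n$. For $\lambda>1$ and real $a$ set $$\phi(\lambda)=\frac{1-\theta^\lambda}{\lambda(1-\theta)},\qquad \mu(a)=\inf_{\lambda>1}\phi(\lambda)e^{\lambda a},\qquad \kappa(\theta)=\sup\{a:\mu(a)<1\}.$$ Then $$\frac{H_n}{\log n}\longrightarrow\frac{1}{\kappa(\theta)}\quad\text{almost surely, as } n\to\infty.$$
   Context: **Model.** $\mathcal{T}_1$ is the tree with the single vertex $1$ (the root of all the trees) and no edges. Given $\mathcal{T}_n$ (vertex set $\{1,\dots,n\}$), $\mathcal{T}_{n+1}$ is obtained by adding vertex $n+1$ and an edge between $n+1$ and a vertex chosen uniformly at random, independently of the past, from $\{v\in\{1,\dots,n\}: j(n)\le v\le n\}$. Macroscopic regime: $j(n)=\lfloor\theta n\rfloor$. The height of a rooted tree is the maximal graph distance of a vertex from the root. *)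

theory Defs
  imports "HOL-Probability.Probability" "Graph_Theory.Pair_Digraph"
begin

text \<open>
  Undirected graphs are represented, as in \<^locale>\<open>pair_graph\<close>, by symmetric arc relations:
  an edge between \<open>u\<close> and \<open>v\<close> is the pair of arcs \<open>(u, v)\<close> and \<open>(v, u)\<close>.
\<close>

text \<open>The value is meaningful only if \<open>v\<close> is reachable from \<open>u\<close> (\<open>Inf {} = 0\<close> for \<^typ>\<open>nat\<close>).\<close>
definition graph_dist :: "('a, 'b) pre_digraph \<Rightarrow> 'a \<Rightarrow> 'a \<Rightarrow> nat" where
  "graph_dist G u v = Inf {length p | p. pre_digraph.awalk G u p v}"

definition tree_height :: "'a \<Rightarrow> ('a, 'b) pre_digraph \<Rightarrow> nat" where
  "tree_height r G = Max (graph_dist G r ` verts G)"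

definition add_leaf :: "'a \<Rightarrow> 'a \<Rightarrow> 'a pair_pre_digraph \<Rightarrow> 'a pair_pre_digraph" where
  "add_leaf x y G =
    \<lparr> pverts = insert x (pverts G), parcs = parcs G \<union> {(x, y), (y, x)} \<rparr>"

text \<open>
  \<open>V n\<close> is the vertex to which the vertex \<open>n + 1\<close> is attached, for \<open>n \<ge> 1\<close>.
  The trees are indexed from \<open>1\<close>; the value at \<open>0\<close> and the choice \<open>V 0\<close> are irrelevant.
\<close>
fun recursive_tree :: "(nat \<Rightarrow> nat) \<Rightarrow> nat \<Rightarrow> nat pair_pre_digraph" where
  "recursive_tree V 0 = \<lparr> pverts = {}, parcs = {} \<rparr>"
| "recursive_tree V (Suc 0) = \<lparr> pverts = {1}, parcs = {} \<rparr>"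
| "recursive_tree V (Suc (Suc n)) =
     add_leaf (Suc (Suc n)) (V (Suc n)) (recursive_tree V (Suc n))"

definition macro_j :: "real \<Rightarrow> nat \<Rightarrow> nat" where
  "macro_j \<theta> n = nat \<lfloor>\<theta> * real n\<rfloor>"

definition memory_window :: "(nat \<Rightarrow> nat) \<Rightarrow> nat \<Rightarrow> nat set" where
  "memory_window j n = {v \<in> {1..n}. j n \<le> v \<and> v \<le> n}"

text \<open>
  The attachment vertices of the recursive trees with limited memory.  Joint independence of
  the family says that, for every \<open>n\<close>, the choice \<open>V n\<close> is independent of
  \<open>V 1, \<dots>, V (n - 1)\<close>, which determine and are determined by the trees up to time \<open>n\<close>.
\<close>
locale limited_memory_choices = prob_space M for M :: "'w measure" +
  fixes j :: "nat \<Rightarrow> nat" and V :: "nat \<Rightarrow> 'w \<Rightarrow> nat"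
  assumes indep_choices: "indep_vars (\<lambda>_. count_space UNIV) V {1..}"
    and uniform_choice:
      "\<And>n. n \<ge> 1 \<Longrightarrow>
         distr M (count_space UNIV) (V n) = measure_pmf (pmf_of_set (memory_window j n))"

definition lm_phi :: "real \<Rightarrow> real \<Rightarrow> real" where
  "lm_phi \<theta> l = (1 - \<theta> powr l) / (l * (1 - \<theta>))"

text \<open>
  For \<open>0 < \<theta> < 1\<close> the infimum is over a nonempty set of positive reals and the supremum is over
  a nonempty set that is bounded above, so the real-valued \<open>Inf\<close> and \<open>Sup\<close> are the genuine ones.
\<close>
definition lm_mu :: "real \<Rightarrow> real \<Rightarrow> real" where
  "lm_mu \<theta> a = (INF l\<in>{1<..}. lm_phi \<theta> l * exp (l * a))"

definition lm_kappa :: "real \<Rightarrow> real" where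
  "lm_kappa \<theta> = Sup {a. lm_mu \<theta> a < 1}"

end

theory Submission
  imports Defs "HOL-Real_Asymp.Real_Asymp" "HOL-Computational_Algebra.Polynomial"
begin

text \<open>
  Write \<open>d(v)\<close> for the distance of the vertex \<open>v\<close> from the root. The parent of a late vertex
  \<open>v\<close> is close to \<open>U v\<close> with \<open>U\<close> uniform on \<open>[\<theta>, 1]\<close>, and \<open>\<phi>(\<lambda>)\<close> is the expectation of
  \<open>U\<close> to the power \<open>\<lambda> - 1\<close>. Along an ancestral line the logarithm of the label is thus a random
  walk with steps \<open>- ln U\<close>, and by Cramer's theorem the expected number of vertices of depth \<open>k\<close>
  with labels up to \<open>exp (a k)\<close> is \<open>\<mu>(a)\<close> to the power \<open>k\<close>, up to factors subexponential in
  \<open>k\<close>. Therefore the first vertex of depth \<open>k\<close> appears near the label \<open>exp (\<kappa> k)\<close>, and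
  the height at time \<open>n\<close> is about \<open>ln n / \<kappa>\<close>. The two halves of this argument give the two bounds.

  Few deep vertices. If \<open>a < \<kappa>\<close>, there are \<open>\<lambda> > 1\<close> and \<open>s > \<lambda> a\<close> with
  \<open>\<phi>(\<lambda>) < exp (- s)\<close>. Averaging \<open>v powr (\<lambda> - 1)\<close> over a memory window multiplies it
  by about \<open>\<phi>(\<lambda>)\<close>, so an induction along the parents bounds the probability of
  \<open>d(v) \<ge> k\<close> by a multiple of \<open>v powr (\<lambda> - 1) * exp (- s k)\<close> (lemma \<open>prob_depth_ge\<close>).
  Summing over \<open>v \<le> exp (a k)\<close> and then over \<open>k\<close>, the Borel-Cantelli lemma shows that almost
  surely, for all large \<open>k\<close>, every label up to \<open>exp (a k)\<close> has depth less than \<open>k\<close>.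

  Enough deep vertices. Let \<open>a > \<kappa>\<close> and cut the labels into blocks between
  consecutive powers of \<open>exp \<delta>\<close>, where the memory spans \<open>L + 1\<close> blocks. A vertex has on average
  about \<open>(1 - exp (- \<delta>)) / (1 - \<theta>)\<close> children in each of the \<open>L\<close> blocks after its own. The choices
  made in one block are independent of the past, so a Chernoff bound and the Borel-Cantelli lemma show that,
  from some block on, the number of vertices of depth at least \<open>k + 1\<close> in a block is at least
  \<open>w\<close> times the number of those of depth at least \<open>k\<close> in the \<open>L\<close> preceding blocks, as long as
  this lower bound exceeds the block index (lemma \<open>AE_block_growth\<close>); here \<open>w\<close> is
  slightly less than the average. Iterating this linear recursion \<open>K\<close> times amounts to taking the
  \<open>K\<close>-th power of the polynomial \<open>P\<close> with coefficients \<open>w\<close> in the degrees \<open>1, \<dots>, L\<close>. For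
  small \<open>\<delta>\<close> the function \<open>w (exp t + \<dots> + exp (L t))\<close> at \<open>t = - \<lambda> \<delta>\<close> is close to \<open>\<phi>(\<lambda>)\<close>, hence
  \<open>P (exp t) * exp (- (a / \<delta>) t)\<close> stays above a constant greater than \<open>1\<close> for \<open>t \<le> 0\<close>
  (lemma \<open>blocks_supercritical\<close>). The lower bound in Cramer's theorem, by exponential tilting, then provides a
  power of \<open>P\<close> with a coefficient greater than \<open>1\<close> in a degree \<open>m\<close> with \<open>\<delta> m \<le> a' K\<close>, for
  any given \<open>a' > a\<close> (lemma \<open>exists_coeff_power_gt_1\<close>). Starting with all vertices of a late block, which have depth at
  least \<open>0\<close>, the population of depth at least \<open>r K\<close> found \<open>r m\<close> blocks later grows geometrically
  in \<open>r\<close>, so it is never empty (lemma \<open>populations_never_empty\<close>).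
\<close>

section \<open>Depth and height\<close>

text \<open>
  The depth of a vertex is the depth of its parent plus one. Both the root and a vertex whose choice is
  not an earlier vertex get the value \<open>0\<close>; the latter happens with probability \<open>0\<close> only, and the guard
  makes the recursion well-founded for every choice sequence.
\<close>
fun lm_depth :: "(nat \<Rightarrow> nat) \<Rightarrow> nat \<Rightarrow> nat" where
  "lm_depth V 0 = 0"
| "lm_depth V (Suc n) = (if 1 \<le> V n \<and> V n \<le> n then Suc (lm_depth V (V n)) else 0)"

lemma lm_depth_less: "n \<ge> 1 \<Longrightarrow> lm_depth V n < n"
proof (induction n rule: less_induct)
  case (less n)
  then obtain m where "n = Suc m" by (cases n) auto
  with less.IH[of "V m"] show ?case by (auto simp: Suc_le_eq)
qed

text \<open>
  The depth of \<open>n\<close> is a function of the choices before time \<open>n\<close>; this is how independence of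
  the choices will be used.
\<close>
lemma lm_depth_cong:
  assumes "\<And>k. 1 \<le> k \<Longrightarrow> k < n \<Longrightarrow> V k = W k"
  shows "lm_depth V n = lm_depth W n"
  using assms
proof (induction n rule: less_induct)
  case (less n)
  show ?case
  proof (cases n)
    case (Suc m)
    show ?thesis
    proof (cases "m = 0")
      case False
      then have "V m = W m" using less.prems[of m] Suc by auto
      moreover have "lm_depth V (W m) = lm_depth W (W m)" if "W m \<le> m"
        using that less Suc by auto
      ultimately show ?thesis using Suc by auto
    qed (use Suc in auto)
  qed auto
qed

lemma pverts_recursive_tree: "n \<ge> 1 \<Longrightarrow> pverts (recursive_tree V n) = {1..n}"
proof (induction V n rule: recursive_tree.induct)
  case (3 V n)
  then show ?case by (auto simp: add_leaf_def)
qed auto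

lemma parcs_recursive_tree:
  "parcs (recursive_tree V n) = {(Suc m, V m) | m. 1 \<le> m \<and> m < n} \<union> {(V m, Suc m) | m. 1 \<le> m \<and> m < n}"
proof (induction V n rule: recursive_tree.induct)
  case (3 V n)
  have "{(Suc m, V m) | m. 1 \<le> m \<and> m < Suc (Suc n)} = insert (Suc (Suc n), V (Suc n)) {(Suc m, V m) | m. 1 \<le> m \<and> m < Suc n}"
    "{(V m, Suc m) | m. 1 \<le> m \<and> m < Suc (Suc n)} = insert (V (Suc n), Suc (Suc n)) {(V m, Suc m) | m. 1 \<le> m \<and> m < Suc n}"
    by (auto simp: less_Suc_eq)
  with 3 show ?case by (auto simp: add_leaf_def)
qed auto

text \<open>
  Depths at the two ends of an arc differ by at most one, so no walk to \<open>v\<close> is shorter than the depth of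
  \<open>v\<close>; the ancestral line of \<open>v\<close> is a walk of exactly this length.
\<close>
lemma graph_dist_recursive_tree:
  assumes V: "\<And>k. 1 \<le> k \<Longrightarrow> k < n \<Longrightarrow> 1 \<le> V k \<and> V k \<le> k" and v: "1 \<le> v" "v \<le> n"
  shows "graph_dist (with_proj (recursive_tree V n)) 1 v = lm_depth V v"
proof -
  let ?G = "recursive_tree V n"
  have aw: "pre_digraph.awalk (with_proj ?G) u p w \<longleftrightarrow> u \<in> {1..n} \<and> set p \<subseteq> parcs ?G \<and> pcas u p w" for u p w
    using v by (simp add: pre_digraph.awalk_def cas_with_proj_eq pverts_recursive_tree)
  have step: "lm_depth V y \<le> Suc (lm_depth V x)" if "(x, y) \<in> parcs ?G" for x y
    using that V by (auto simp: parcs_recursive_tree)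
  have lower: "lm_depth V w \<le> lm_depth V u + length p" if "set p \<subseteq> parcs ?G" "pcas u p w" for u p w
    using that
  proof (induction p arbitrary: u)
    case (Cons e p)
    then show ?case using step[of u "snd e"] by (cases e) force
  qed auto
  have pcas_append: "pcas u (p @ [(x, y)]) y" if "pcas u p x" for u p and x y :: nat
    using that by (induction p arbitrary: u) auto
  have upper: "\<exists>p. set p \<subseteq> parcs ?G \<and> pcas 1 p w \<and> length p = lm_depth V w" if "1 \<le> w" "w \<le> n" for w
    using that
  proof (induction w rule: less_induct)
    case (less w)
    show ?case
    proof (cases "w = 1")
      case True
      then show ?thesis by (intro exI[of _ "[]"]) auto
    next
      case False
      then obtain m where m: "w = Suc m" "1 \<le> m" "m < n" using less.prems by (cases w) auto
      then obtain p where p: "set p \<subseteq> parcs ?G" "pcas 1 p (V m)" "length p = lm_depth V (V m)"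
        using less.IH[of "V m"] V[of m] by fastforce
      have "(V m, w) \<in> parcs ?G" using m by (auto simp: parcs_recursive_tree)
      then show ?thesis
        using p m V[of m] pcas_append[OF p(2)] by (intro exI[of _ "p @ [(V m, w)]"]) auto
    qed
  qed
  obtain p where p: "pre_digraph.awalk (with_proj ?G) 1 p v" "length p = lm_depth V v"
    using upper[OF v] v by (auto simp: aw)
  show ?thesis unfolding graph_dist_def
  proof (rule antisym)
    show "Inf {length p |p. pre_digraph.awalk (with_proj ?G) 1 p v} \<le> lm_depth V v"
      using p by (intro wellorder_Inf_le1) (auto intro: exI[of _ p])
    show "lm_depth V v \<le> Inf {length p |p. pre_digraph.awalk (with_proj ?G) 1 p v}"
    proof (rule cInf_greatest)
      show "{length p |p. pre_digraph.awalk (with_proj ?G) 1 p v} \<noteq> {}" using p by auto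
      fix q assume "q \<in> {length p |p. pre_digraph.awalk (with_proj ?G) 1 p v}"
      then obtain p where "q = length p" "set p \<subseteq> parcs ?G" "pcas 1 p v" by (auto simp: aw)
      then show "lm_depth V v \<le> q" using lower[of p 1 v] by (auto split: if_splits)
    qed
  qed
qed

lemma tree_height_recursive_tree:
  assumes "\<And>k. 1 \<le> k \<Longrightarrow> k < n \<Longrightarrow> 1 \<le> V k \<and> V k \<le> k" "1 \<le> n"
  shows "tree_height 1 (with_proj (recursive_tree V n)) = Max (lm_depth V ` {1..n})"
proof -
  have "graph_dist (with_proj (recursive_tree V n)) 1 ` {1..n} = lm_depth V ` {1..n}"
    using assms graph_dist_recursive_tree[of n V] by (intro image_cong) auto
  then show ?thesis using assms by (simp add: tree_height_def pverts_recursive_tree)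
qed

section \<open>The functions \<open>\<phi>\<close> and \<open>\<mu>\<close> and the threshold \<open>\<kappa>\<close>\<close>

lemma lm_phi_pos: "0 < \<theta> \<Longrightarrow> \<theta> < 1 \<Longrightarrow> 0 < l \<Longrightarrow> 0 < lm_phi \<theta> l"
  using powr_less_mono2[of l \<theta> 1] by (auto simp: lm_phi_def intro!: divide_pos_pos)

lemma lm_mu_le:
  assumes "0 < \<theta>" "\<theta> < 1" "1 < l"
  shows "lm_mu \<theta> a \<le> lm_phi \<theta> l * exp (l * a)"
  unfolding lm_mu_def
proof (rule cINF_lower)
  show "bdd_below ((\<lambda>l. lm_phi \<theta> l * exp (l * a)) ` {1<..})"
    using lm_phi_pos[OF assms(1,2)] by (intro bdd_belowI[of _ 0]) (auto intro: less_imp_le)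
qed (use assms in auto)

lemma lm_mu_less_1D:
  assumes "lm_mu \<theta> a < 1"
  shows "\<exists>l>1. lm_phi \<theta> l * exp (l * a) < 1"
proof (rule ccontr)
  assume "\<not> ?thesis"
  then have "1 \<le> lm_mu \<theta> a" unfolding lm_mu_def by (intro cINF_greatest) (auto simp: not_less, metis linorder_not_less)
  with assms show False by simp
qed

text \<open>
  The bound rests on \<open>\<phi>(l) \<ge> 1 / l\<close>, which gives \<open>\<phi>(l) * exp (l a) \<ge> 1\<close> for all \<open>l > 1\<close> as soon as
  \<open>a \<ge> 1\<close>.
\<close>
lemma bdd_above_lm_mu_less_1:
  assumes "0 < \<theta>" "\<theta> < 1"
  shows "bdd_above {a. lm_mu \<theta> a < 1}"
proof (rule bdd_aboveI)
  fix a assume "a \<in> {a. lm_mu \<theta> a < 1}"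
  then obtain l where l: "1 < l" "lm_phi \<theta> l * exp (l * a) < 1" using lm_mu_less_1D by auto
  have "\<theta> powr l \<le> \<theta> powr 1" using l assms by (intro powr_mono') auto
  then have "1 / l \<le> lm_phi \<theta> l" using l assms by (simp add: lm_phi_def field_simps)
  show "a \<le> 1"
  proof (rule ccontr)
    assume "\<not> a \<le> 1"
    then have "l * 1 \<le> l * a" using l by (intro mult_left_mono) auto
    then have "l \<le> exp (l * a)" using exp_ge_add_one_self[of "l * a"] by linarith
    then have "1 \<le> 1 / l * exp (l * a)" using l by (simp add: field_simps)
    also have "\<dots> \<le> lm_phi \<theta> l * exp (l * a)" using \<open>1 / l \<le> _\<close> by (intro mult_right_mono) auto
    finally show False using l by simp
  qed
qed

lemma lm_phi_less_1:
  assumes "0 < \<theta>" "\<theta> < 1"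
  obtains l where "1 < l" "lm_phi \<theta> l < 1"
proof -
  define l where "l = 1 / (1 - \<theta>) + 1"
  have "l * (1 - \<theta>) = 1 + (1 - \<theta>)" using assms by (simp add: l_def distrib_right)
  then have l: "1 < l" "1 < l * (1 - \<theta>)" using assms by (auto simp: l_def)
  have "1 - \<theta> powr l < 1 * (l * (1 - \<theta>))" using l assms powr_gt_zero[of \<theta> l] by linarith
  then have "lm_phi \<theta> l < 1" unfolding lm_phi_def using l by (subst divide_less_eq) auto
  with l that show thesis by blast
qed

text \<open>
  Since \<open>\<phi>(l) < 1\<close> for large \<open>l\<close>, the factor \<open>exp (l a)\<close> with a small positive \<open>a\<close> can be
  afforded.
\<close>
lemma lm_kappa_pos:
  assumes "0 < \<theta>" "\<theta> < 1"
  shows "0 < lm_kappa \<theta>"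
proof -
  obtain l where l: "1 < l" and phi: "lm_phi \<theta> l < 1" using lm_phi_less_1[OF assms] .
  define p where "p = lm_phi \<theta> l"
  have p: "0 < p" "p < 1" using lm_phi_pos[OF assms, of l] l phi by (auto simp: p_def)
  define a where "a = - ln p / (2 * l)"
  have "a > 0" using p l by (auto simp: a_def intro!: divide_neg_pos)
  have "lm_mu \<theta> a \<le> p * exp (l * a)" unfolding p_def using lm_mu_le[OF assms l(1)] .
  also have "\<dots> = exp (ln p + l * a)" using p by (simp add: exp_add)
  also have "\<dots> = exp (ln p / 2)" using l by (simp add: a_def field_simps)
  also have "\<dots> < 1" using p by simp
  finally have "a \<le> lm_kappa \<theta>"
    unfolding lm_kappa_def by (intro cSup_upper bdd_above_lm_mu_less_1 assms) auto
  with \<open>a > 0\<close> show ?thesis by simp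
qed

lemma below_lm_kappaD:
  assumes "0 < \<theta>" "\<theta> < 1" "a < lm_kappa \<theta>"
  obtains l where "1 < l" "lm_phi \<theta> l * exp (l * a) < 1"
proof -
  obtain l0 where "1 < l0" "lm_phi \<theta> l0 < 1" using lm_phi_less_1[OF assms(1,2)] .
  then have "lm_mu \<theta> 0 < 1" using lm_mu_le[OF assms(1,2), of l0 0] by simp
  then have "{a. lm_mu \<theta> a < 1} \<noteq> {}" by auto
  then obtain a' where "lm_mu \<theta> a' < 1" "a < a'"
    using assms less_cSup_iff[OF _ bdd_above_lm_mu_less_1, of \<theta> a] by (auto simp: lm_kappa_def)
  then obtain l where l: "1 < l" "lm_phi \<theta> l * exp (l * a') < 1" using lm_mu_less_1D by blast
  have "lm_phi \<theta> l * exp (l * a) \<le> lm_phi \<theta> l * exp (l * a')"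
    using \<open>a < a'\<close> l lm_phi_pos[OF assms(1,2), of l] by (intro mult_left_mono) auto
  with l that show thesis by auto
qed

lemma above_lm_kappaD:
  assumes "0 < \<theta>" "\<theta> < 1" "lm_kappa \<theta> < a" "1 < l"
  shows "1 \<le> lm_phi \<theta> l * exp (l * a)"
proof -
  have "a \<notin> {a. lm_mu \<theta> a < 1}"
    using cSup_upper[OF _ bdd_above_lm_mu_less_1[OF assms(1,2)], of a] assms(3) by (auto simp: lm_kappa_def)
  then show ?thesis using lm_mu_le[OF assms(1,2,4), of a] by simp
qed

section \<open>Memory windows\<close>

lemma memory_window_macro: "memory_window (macro_j \<theta>) n = {max 1 (macro_j \<theta> n)..n}"
  by (auto simp: memory_window_def)

lemma memory_window_macro_nonempty:
  assumes "0 < \<theta>" "\<theta> < 1" "1 \<le> n"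
  shows "memory_window (macro_j \<theta>) n \<noteq> {}"
proof -
  have "\<theta> * n \<le> 1 * real n" using assms by (intro mult_right_mono) auto
  then have "macro_j \<theta> n \<le> n" by (simp add: macro_j_def nat_le_iff floor_le_iff)
  then show ?thesis using assms by (auto simp: memory_window_macro)
qed

lemma card_memory_window_macro_le:
  assumes "0 < \<theta>" "\<theta> < 1" "1 \<le> n"
  shows "real (card (memory_window (macro_j \<theta>) n)) \<le> (1 - \<theta>) * n + 2"
proof -
  have "macro_j \<theta> n \<le> n" using memory_window_macro_nonempty[OF assms] by (auto simp: memory_window_macro)
  then have "real (card (memory_window (macro_j \<theta>) n)) \<le> real n + 1 - real (macro_j \<theta> n)"
    using assms by (auto simp: memory_window_macro max_def of_nat_diff)
  moreover have "\<theta> * n - 1 \<le> macro_j \<theta> n"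
  proof -
    have "\<theta> * n - 1 \<le> real_of_int \<lfloor>\<theta> * n\<rfloor>" by linarith
    also have "\<dots> \<le> real (nat \<lfloor>\<theta> * n\<rfloor>)" by simp
    finally show ?thesis unfolding macro_j_def .
  qed
  ultimately show ?thesis by (simp add: algebra_simps)
qed

text \<open>
  By the mean value theorem the sum over the window is at most the integral of \<open>x powr (l - 1)\<close> from the
  left end \<open>m n\<close> of the window to \<open>n + 1\<close>. With \<open>r = m n / (n + 1)\<close>, which tends to \<open>\<theta>\<close>, the
  resulting average, in units of \<open>(n + 1) powr (l - 1)\<close>, is
  \<open>(1 - r powr l) / (l * (1 - r))\<close>, whose limit is \<open>\<phi>(l)\<close>.
\<close>
lemma window_average:
  assumes \<theta>: "0 < \<theta>" "\<theta> < 1" and l: "1 < l" and c: "lm_phi \<theta> l < c"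
  shows "eventually (\<lambda>n. (\<Sum>v\<in>memory_window (macro_j \<theta>) n. real v powr (l - 1))
    \<le> c * real (card (memory_window (macro_j \<theta>) n)) * real (Suc n) powr (l - 1)) sequentially"
proof -
  define m where "m n = max 1 (macro_j \<theta> n)" for n
  define r where "r n = real (m n) / real (Suc n)" for n
  have m_bounds: "\<theta> * n - 1 \<le> m n" "m n \<le> \<theta> * n + 1" for n
    using \<theta> by (auto simp: m_def macro_j_def max_def) linarith+
  have "r \<longlonglongrightarrow> \<theta>"
  proof (rule tendsto_sandwich)
    show "eventually (\<lambda>n. (\<theta> * n - 1) / Suc n \<le> r n) sequentially"
      "eventually (\<lambda>n. r n \<le> (\<theta> * n + 1) / Suc n) sequentially"
      using m_bounds by (auto simp: r_def intro!: divide_right_mono always_eventually)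
  qed real_asymp+
  then have "(\<lambda>n. (1 - r n powr l) / (l * (1 - r n))) \<longlonglongrightarrow> lm_phi \<theta> l"
    unfolding lm_phi_def using \<theta> l by (intro tendsto_intros) auto
  then have ev: "eventually (\<lambda>n. (1 - r n powr l) / (l * (1 - r n)) < c) sequentially"
    using c by (rule order_tendstoD)
  have "eventually (\<lambda>n. r n < 1) sequentially" using \<open>r \<longlonglongrightarrow> \<theta>\<close> \<theta> by (auto dest: order_tendstoD)
  with ev eventually_gt_at_top[of 0] show ?thesis
  proof eventually_elim
    case (elim n)
    have "m n \<le> n" using elim by (auto simp: r_def m_def divide_less_eq)
    have mean_value: "real v powr (l - 1) \<le> (real (Suc v) powr l - real v powr l) / l" if "v \<ge> 1" for v
    proof -
      have "\<exists>z. real v < z \<and> z < real (Suc v) \<and> real (Suc v) powr l - real v powr l = (real (Suc v) - real v) * (l * z powr (l - 1))"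
        using that by (intro MVT2) (auto intro!: derivative_eq_intros)
      then obtain z where z: "real v < z" "real (Suc v) powr l - real v powr l = l * z powr (l - 1)" by auto
      have "real v powr (l - 1) \<le> z powr (l - 1)" using z l by (intro powr_mono2) auto
      then show ?thesis using z l by simp
    qed
    have "(\<Sum>v\<in>memory_window (macro_j \<theta>) n. real v powr (l - 1)) \<le> (\<Sum>v = m n..n. (real (Suc v) powr l - real v powr l) / l)"
      unfolding memory_window_macro m_def by (intro sum_mono mean_value) auto
    also have "\<dots> = (\<Sum>v = m n..<Suc n. (real (Suc v) powr l - real v powr l)) / l"
      by (simp add: sum_divide_distrib atLeastLessThanSuc_atLeastAtMost)
    also have "\<dots> = (real (Suc n) powr l - real (m n) powr l) / l"
      using \<open>m n \<le> n\<close> by (subst sum_Suc_diff') auto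
    also have "\<dots> = (1 - r n powr l) / (l * (1 - r n)) * (real (Suc n) powr l * (1 - r n))"
    proof -
      have "real (m n) powr l = real (Suc n) powr l * r n powr l" by (simp add: r_def flip: powr_mult)
      then show ?thesis using elim l by (simp add: field_simps)
    qed
    also have "\<dots> \<le> c * (real (Suc n) powr l * (1 - r n))"
      using elim by (intro mult_right_mono) auto
    also have "real (Suc n) powr l * (1 - r n) = real (Suc n - m n) * real (Suc n) powr (l - 1)"
      using \<open>m n \<le> n\<close> by (simp add: r_def powr_diff field_simps of_nat_diff)
    also have "Suc n - m n = card (memory_window (macro_j \<theta>) n)"
      by (simp add: memory_window_macro m_def)
    finally show ?case by (simp add: mult.assoc)
  qed
qed

section \<open>Independence of the choices\<close>

context limited_memory_choices
begin

lemma measurable_V [measurable]: "n \<ge> 1 \<Longrightarrow> V n \<in> measurable M (count_space UNIV)"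
  using indep_choices unfolding indep_vars_def by auto

text \<open>
  A finite family of choices takes countably many values, so every predicate of it is an event;
  predicates of disjoint families of choices are independent.
\<close>
lemma
  assumes fin: "finite A" and A: "A \<subseteq> {1..}"
    and Q: "\<And>v w. (\<And>n. n \<in> A \<Longrightarrow> v n = w n) \<Longrightarrow> Q v = Q w"
  shows events_choices: "{\<omega> \<in> space M. Q (\<lambda>n. V n \<omega>)} \<in> events"
    and indep_events_choices: "finite B \<Longrightarrow> B \<subseteq> {1..} \<Longrightarrow> A \<inter> B = {} \<Longrightarrow>
      (\<And>v w. (\<And>n. n \<in> B \<Longrightarrow> v n = w n) \<Longrightarrow> R v = R w) \<Longrightarrow>
      prob {\<omega> \<in> space M. Q (\<lambda>n. V n \<omega>) \<and> R (\<lambda>n. V n \<omega>)} =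
      prob {\<omega> \<in> space M. Q (\<lambda>n. V n \<omega>)} * prob {\<omega> \<in> space M. R (\<lambda>n. V n \<omega>)}"
proof -
  define N where "N A = (\<Pi>\<^sub>M n\<in>A. count_space (UNIV :: nat set))" for A :: "nat set"
  define X where "X A \<omega> = restrict (\<lambda>n. V n \<omega>) A" for A \<omega>
  have space: "space (N A) = PiE A (\<lambda>_. UNIV)" for A by (simp add: N_def space_PiM)
  have sets: "S \<in> sets (N A)" if "finite A" "S \<subseteq> space (N A)" for S A
  proof -
    have "countable S" using that countable_PiE[of A "\<lambda>_. UNIV :: nat set"]
      unfolding space by (blast intro: countable_subset)
    moreover have "{f} \<in> sets (N A)" if "f \<in> S" for f
    proof -
      have "{f} = PiE A (\<lambda>n. {f n})" using that \<open>S \<subseteq> space (N A)\<close> unfolding space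
        by (subst PiE_singleton) (auto simp: PiE_def)
      then show ?thesis using \<open>finite A\<close> unfolding N_def by (auto intro!: sets_PiM_I_finite)
    qed
    ultimately have "(\<Union>f\<in>S. {f}) \<in> sets (N A)" by (intro sets.countable_UN'') auto
    then show ?thesis by simp
  qed
  have meas: "X A \<in> measurable M (N A)" if "A \<subseteq> {1..}" for A
    unfolding X_def N_def using that by (intro measurable_restrict measurable_V) auto
  have vimage: "{\<omega> \<in> space M. Q (\<lambda>n. V n \<omega>)} = X A -` {f \<in> space (N A). Q f} \<inter> space M"
    if "A \<subseteq> {1..}" "\<And>v w. (\<And>n. n \<in> A \<Longrightarrow> v n = w n) \<Longrightarrow> Q v = Q w" for A Q
  proof -
    have "Q (X A \<omega>) = Q (\<lambda>n. V n \<omega>)" for \<omega> by (rule that(2)) (simp add: X_def)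
    moreover have "X A \<omega> \<in> space (N A)" for \<omega> by (simp add: space X_def)
    ultimately show ?thesis by auto
  qed
  have "X A -` {f \<in> space (N A). Q f} \<inter> space M \<in> events"
    by (rule measurable_sets[OF meas[OF A] sets[OF fin]]) auto
  then show "{\<omega> \<in> space M. Q (\<lambda>n. V n \<omega>)} \<in> events"
    by (subst vimage[of A Q, OF A Q])
  assume B: "finite B" "B \<subseteq> {1..}" "A \<inter> B = {}"
    and R: "\<And>v w. (\<And>n. n \<in> B \<Longrightarrow> v n = w n) \<Longrightarrow> R v = R w"
  have indep: "indep_var (N A) (X A) (N B) (X B)"
    unfolding N_def X_def using indep_var_restrict[OF indep_choices B(3) A B(2)] by simp
  have eqA: "{\<omega> \<in> space M. Q (\<lambda>n. V n \<omega>)} = X A -` {f \<in> space (N A). Q f} \<inter> space M"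
    by (rule vimage) (fact A, fact Q)
  have eqB: "{\<omega> \<in> space M. R (\<lambda>n. V n \<omega>)} = X B -` {f \<in> space (N B). R f} \<inter> space M"
    by (rule vimage) (fact B(2), fact R)
  from indep_varD[OF indep sets[OF fin] sets[OF B(1)], of "{f \<in> space (N A). Q f}" "{f \<in> space (N B). R f}"]
  have "prob ((X A -` {f \<in> space (N A). Q f} \<inter> space M) \<inter> (X B -` {f \<in> space (N B). R f} \<inter> space M))
    = prob (X A -` {f \<in> space (N A). Q f} \<inter> space M) * prob (X B -` {f \<in> space (N B). R f} \<inter> space M)"
    by (auto simp: vimage_def Int_def conj_ac intro: arg_cong[where f = prob])
  then have "prob ({\<omega> \<in> space M. Q (\<lambda>n. V n \<omega>)} \<inter> {\<omega> \<in> space M. R (\<lambda>n. V n \<omega>)}) =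
      prob {\<omega> \<in> space M. Q (\<lambda>n. V n \<omega>)} * prob {\<omega> \<in> space M. R (\<lambda>n. V n \<omega>)}"
    by (simp only: eqA eqB)
  moreover have "{\<omega> \<in> space M. Q (\<lambda>n. V n \<omega>)} \<inter> {\<omega> \<in> space M. R (\<lambda>n. V n \<omega>)} =
      {\<omega> \<in> space M. Q (\<lambda>n. V n \<omega>) \<and> R (\<lambda>n. V n \<omega>)}" by auto
  ultimately show "prob {\<omega> \<in> space M. Q (\<lambda>n. V n \<omega>) \<and> R (\<lambda>n. V n \<omega>)} =
      prob {\<omega> \<in> space M. Q (\<lambda>n. V n \<omega>)} * prob {\<omega> \<in> space M. R (\<lambda>n. V n \<omega>)}" by simp
qed

lemma finite_memory_window: "finite (memory_window j n)"
  by (auto simp: memory_window_def)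

lemma prob_choice:
  assumes "n \<ge> 1" "memory_window j n \<noteq> {}"
  shows "prob {\<omega> \<in> space M. V n \<omega> \<in> S} = real (card (memory_window j n \<inter> S)) / real (card (memory_window j n))"
proof -
  have "prob {\<omega> \<in> space M. V n \<omega> \<in> S} = measure (distr M (count_space UNIV) (V n)) S"
    using assms by (subst measure_distr) (auto simp: vimage_def Int_def conj_commute intro!: arg_cong[where f = prob])
  also have "\<dots> = real (card (memory_window j n \<inter> S)) / real (card (memory_window j n))"
    using assms finite_memory_window by (simp add: uniform_choice measure_pmf_of_set)
  finally show ?thesis .
qed

lemma AE_choice_in_window:
  assumes "\<And>n. n \<ge> 1 \<Longrightarrow> memory_window j n \<noteq> {}"
  shows "AE \<omega> in M. \<forall>n\<ge>1. V n \<omega> \<in> memory_window j n"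
proof -
  have "AE \<omega> in M. n \<ge> 1 \<longrightarrow> V n \<omega> \<in> memory_window j n" for n
  proof (cases "n \<ge> 1")
    case True
    have "prob {\<omega> \<in> space M. V n \<omega> \<in> memory_window j n} = 1"
      using True assms[OF True] finite_memory_window by (subst prob_choice) auto
    then have "AE \<omega> in M. V n \<omega> \<in> memory_window j n"
      using True by (subst (asm) prob_Collect_eq_1) auto
    then show ?thesis by simp
  qed simp
  then show ?thesis by (simp add: AE_all_countable)
qed

abbreviation depth :: "'w \<Rightarrow> nat \<Rightarrow> nat" where
  "depth \<omega> \<equiv> lm_depth (\<lambda>n. V n \<omega>)"

lemma events_depth: "{\<omega> \<in> space M. k \<le> depth \<omega> n} \<in> events"
  by (rule events_choices[of "{1..<n}"]) (auto intro!: arg_cong2[of _ _ _ _ "(\<le>)"] lm_depth_cong)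

section \<open>Labels of deep vertices: first moment bound\<close>

text \<open>
  Induction along the parent: the parent \<open>v\<close> of \<open>n\<close> is independent of the depths before it, so the
  probability for \<open>n\<close> and \<open>k + 1\<close> is the average of those for \<open>v\<close> and \<open>k\<close> over the window, and the
  hypothesis on averages of \<open>v powr (l - 1)\<close> gains the factor \<open>exp (- s)\<close>. The constant
  \<open>exp (s * n\<^sub>0)\<close> covers the finitely many \<open>n\<close> for which the hypothesis is not available, because the
  depth of such an \<open>n\<close> is less than \<open>n\<^sub>0\<close>.
\<close>
lemma prob_depth_ge:
  assumes ne: "\<And>n. n \<ge> 1 \<Longrightarrow> memory_window j n \<noteq> {}"
    and avg: "\<And>n. n \<ge> n\<^sub>0 \<Longrightarrow> (\<Sum>v\<in>memory_window j n. real v powr (l - 1))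
        \<le> exp (- s) * real (card (memory_window j n)) * real (Suc n) powr (l - 1)"
    and n0: "1 \<le> n\<^sub>0" and l: "1 \<le> l" and s: "0 \<le> s" and n: "1 \<le> n"
  shows "prob {\<omega> \<in> space M. k \<le> depth \<omega> n} \<le> exp (s * n\<^sub>0) * real n powr (l - 1) * exp (- s * k)"
  using n
proof (induction n arbitrary: k rule: less_induct)
  case (less n)
  have small_k: ?case if "k \<le> n\<^sub>0"
  proof -
    have "1 * 1 \<le> exp (s * n\<^sub>0 - s * k) * real n powr (l - 1)"
      using that s l less.prems by (intro mult_mono ge_one_powr_ge_zero) (auto intro: mult_left_mono)
    then have "1 \<le> exp (s * n\<^sub>0) * real n powr (l - 1) * exp (- s * k)"
      by (simp add: exp_diff exp_minus field_simps)
    then show ?thesis using prob_le_1 by (rule order_trans[rotated])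
  qed
  show ?case
  proof (cases "n \<le> n\<^sub>0")
    case True
    show ?thesis
    proof (cases "k < n")
      case False
      then have "depth \<omega> n < k" for \<omega>
        using lm_depth_less[OF less.prems, of "\<lambda>n. V n \<omega>"] by linarith
      then have "{\<omega> \<in> space M. k \<le> depth \<omega> n} = {}" by (auto simp: not_le)
      then show ?thesis by (simp only: measure_empty) simp
    qed (use True small_k in auto)
  next
    case False
    then obtain m where m: "n = Suc m" "n\<^sub>0 \<le> m" "1 \<le> m" using n0 by (cases n) auto
    show ?thesis
    proof (cases k)
      case 0
      then show ?thesis using small_k by simp
    next
      case (Suc k')
      let ?W = "memory_window j m"
      let ?E = "\<lambda>v. {\<omega> \<in> space M. V m \<omega> = v \<and> k' \<le> depth \<omega> v}"
      have W: "finite ?W" "0 < real (card ?W)" "?W \<subseteq> {1..m}"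
        using finite_memory_window ne[OF m(3)] by (auto simp: card_gt_0_iff memory_window_def)
      have E: "?E v \<in> events" "prob (?E v) = prob {\<omega> \<in> space M. V m \<omega> = v} * prob {\<omega> \<in> space M. k' \<le> depth \<omega> v}"
        if "v \<in> {1..m}" for v
      proof -
        have cong: "lm_depth f v = lm_depth g v" if "\<And>n. n \<in> {1..<v} \<Longrightarrow> f n = g n" for f g
          using that by (intro lm_depth_cong) simp
        show "?E v \<in> events"
        proof (rule events_choices[of "{1..m}" "\<lambda>f. f m = v \<and> k' \<le> lm_depth f v"])
          fix f g :: "nat \<Rightarrow> nat" assume eq: "\<And>n. n \<in> {1..m} \<Longrightarrow> f n = g n"
          have "f m = g m" "lm_depth f v = lm_depth g v" using that m by (intro eq cong; simp)+
          then show "(f m = v \<and> k' \<le> lm_depth f v) = (g m = v \<and> k' \<le> lm_depth g v)" by (simp only:)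
        qed auto
        show "prob (?E v) = prob {\<omega> \<in> space M. V m \<omega> = v} * prob {\<omega> \<in> space M. k' \<le> depth \<omega> v}"
        proof (rule indep_events_choices[of "{m}" "\<lambda>f. f m = v" "{1..<v}" "\<lambda>f. k' \<le> lm_depth f v"])
          fix f g :: "nat \<Rightarrow> nat"
          show "(f m = v) = (g m = v)" if "\<And>n. n \<in> {m} \<Longrightarrow> f n = g n" using that[of m] by simp
          show "(k' \<le> lm_depth f v) = (k' \<le> lm_depth g v)" if "\<And>n. n \<in> {1..<v} \<Longrightarrow> f n = g n"
            by (simp only: cong[of f g, OF that])
        qed (use that m in auto)
      qed
      have "{\<omega> \<in> space M. k \<le> depth \<omega> n} = (\<Union>v\<in>{1..m}. ?E v)" using m Suc by auto
      then have "prob {\<omega> \<in> space M. k \<le> depth \<omega> n} = prob (\<Union>v\<in>{1..m}. ?E v)" by (simp only:)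
      also have "\<dots> \<le> (\<Sum>v\<in>{1..m}. prob (?E v))"
        by (intro finite_measure_subadditive_finite image_subsetI E(1)) auto
      also have "\<dots> = (\<Sum>v\<in>{1..m}. prob {\<omega> \<in> space M. V m \<omega> = v} * prob {\<omega> \<in> space M. k' \<le> depth \<omega> v})"
        by (intro sum.cong refl E(2))
      also have "\<dots> = (\<Sum>v\<in>{1..m}. if v \<in> ?W then prob {\<omega> \<in> space M. k' \<le> depth \<omega> v} / card ?W else 0)"
        using prob_choice[OF m(3) ne[OF m(3)], of "{v}" for v] by (intro sum.cong) auto
      also have "\<dots> = (\<Sum>v\<in>?W. prob {\<omega> \<in> space M. k' \<le> depth \<omega> v}) / card ?W"
        using W by (simp add: sum.If_cases Int_absorb1 sum_divide_distrib)
      also have "\<dots> \<le> (\<Sum>v\<in>?W. exp (s * n\<^sub>0) * real v powr (l - 1) * exp (- s * k')) / card ?W"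
        using W m by (intro divide_right_mono sum_mono less.IH) auto
      also have "\<dots> = exp (s * n\<^sub>0) * exp (- s * k') * ((\<Sum>v\<in>?W. real v powr (l - 1)) / card ?W)"
        by (simp only: sum_distrib_left times_divide_eq_right mult_ac)
      also have "\<dots> \<le> exp (s * n\<^sub>0) * exp (- s * k') * (exp (- s) * real (Suc m) powr (l - 1))"
        using avg[OF m(2)] W by (intro mult_left_mono) (simp_all add: divide_le_eq mult_ac)
      also have "\<dots> = exp (s * n\<^sub>0) * real n powr (l - 1) * exp (- s * k)"
      proof -
        have "exp (- s * k) = exp (- s * k') * exp (- s)" using Suc by (simp add: mult_exp_exp algebra_simps)
        then show ?thesis using m(1) by (simp only: mult_ac)
      qed
      finally show ?thesis .
    qed
  qed
qed

text \<open>
  There are at most \<open>exp (a * k)\<close> labels to consider, each contributing at most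
  \<open>exp (a * k) powr (l - 1) * exp (- s * k)\<close> up to a constant, so the probability that one of them has depth
  \<open>k\<close> or more decays like \<open>exp (l * a - s) ^ k\<close>.
\<close>
lemma AE_depth_less:
  assumes ne: "\<And>n. n \<ge> 1 \<Longrightarrow> memory_window j n \<noteq> {}"
    and avg: "\<And>n. n \<ge> n\<^sub>0 \<Longrightarrow> (\<Sum>v\<in>memory_window j n. real v powr (l - 1))
        \<le> exp (- s) * real (card (memory_window j n)) * real (Suc n) powr (l - 1)"
    and n0: "1 \<le> n\<^sub>0" and l: "1 \<le> l" and s: "0 \<le> s" and a: "l * a < s"
  shows "AE \<omega> in M. \<forall>\<^sub>F k in sequentially. \<forall>v\<ge>1. real v \<le> exp (a * real k) \<longrightarrow> depth \<omega> v < k"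
proof -
  define N where "N k = nat \<lfloor>exp (a * real k)\<rfloor>" for k
  have N: "v \<le> N k \<longleftrightarrow> real v \<le> exp (a * real k)" for v k
    unfolding N_def by (simp add: le_nat_iff le_floor_iff)
  define E where "E k = (\<Union>v\<in>{1..N k}. {\<omega> \<in> space M. k \<le> depth \<omega> v})" for k
  have E: "E k \<in> events" for k unfolding E_def using events_depth by auto
  have bound: "prob (E k) \<le> exp (s * n\<^sub>0) * exp (l * a - s) ^ k" for k
  proof -
    have "prob (E k) \<le> (\<Sum>v\<in>{1..N k}. prob {\<omega> \<in> space M. k \<le> depth \<omega> v})"
      unfolding E_def using events_depth by (intro finite_measure_subadditive_finite) auto
    also have "\<dots> \<le> (\<Sum>v\<in>{1..N k}. exp (s * n\<^sub>0) * exp (a * k) powr (l - 1) * exp (- s * k))"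
    proof (rule sum_mono)
      fix v assume v: "v \<in> {1..N k}"
      have "prob {\<omega> \<in> space M. k \<le> depth \<omega> v} \<le> exp (s * n\<^sub>0) * real v powr (l - 1) * exp (- s * k)"
        using v by (intro prob_depth_ge[OF ne avg n0 l s]) simp_all
      also have "\<dots> \<le> exp (s * n\<^sub>0) * exp (a * k) powr (l - 1) * exp (- s * k)"
        using v N l by (intro mult_right_mono mult_left_mono powr_mono2) auto
      finally show "prob {\<omega> \<in> space M. k \<le> depth \<omega> v} \<le> exp (s * n\<^sub>0) * exp (a * k) powr (l - 1) * exp (- s * k)" .
    qed
    also have "\<dots> = real (N k) * (exp (s * n\<^sub>0) * exp (a * k) powr (l - 1) * exp (- s * k))" by simp
    also have "\<dots> \<le> exp (a * k) * (exp (s * n\<^sub>0) * exp (a * k) powr (l - 1) * exp (- s * k))"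
      using N by (intro mult_right_mono) auto
    also have "\<dots> = exp (s * n\<^sub>0) * exp (l * a - s) ^ k"
    proof -
      have "exp (l * a - s) ^ k = exp (real k * (l * a - s))" by (simp only: exp_of_nat_mult)
      then show ?thesis by (simp only: powr_def mult_exp_exp) (simp add: mult_exp_exp algebra_simps)
    qed
    finally show ?thesis .
  qed
  have "summable (\<lambda>k. exp (s * n\<^sub>0) * exp (l * a - s) ^ k)"
    using a by (intro summable_mult summable_geometric) auto
  then have "summable (\<lambda>k. prob (E k))"
    by (rule summable_comparison_test'[where N = 0]) (use bound in simp)
  then have "AE \<omega> in M. eventually (\<lambda>k. \<omega> \<in> space M - E k) sequentially"
    using borel_cantelli_AE1[of E M, OF E] by (simp add: emeasure_eq_measure)
  then show ?thesis
  proof eventually_elim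
    case (elim \<omega>)
    then show ?case
      by eventually_elim (auto simp: E_def N not_le)
  qed
qed

lemma AE_shallow_vertices:
  assumes \<theta>: "0 < \<theta>" "\<theta> < 1" and j: "j = macro_j \<theta>" and a: "0 < a" "a < lm_kappa \<theta>"
  shows "AE \<omega> in M. \<forall>\<^sub>F k in sequentially. \<forall>v\<ge>1. real v \<le> exp (a * real k) \<longrightarrow> depth \<omega> v < k"
proof -
  obtain l where l: "1 < l" "lm_phi \<theta> l * exp (l * a) < 1" using below_lm_kappaD[OF \<theta> a(2)] .
  define p where "p = lm_phi \<theta> l"
  have p: "0 < p" using lm_phi_pos[OF \<theta>, of l] l by (simp add: p_def)
  have "exp (ln p + l * a) < exp 0" using l p by (simp add: exp_add p_def)
  then have "l * a < - ln p" by (simp only: exp_less_cancel_iff)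
  \<comment> \<open>The strict inequalities leave room both for the error in the window averages, which asks for
    \<open>\<phi>(l) < exp (- s)\<close>, and for the union bound over the labels, which asks for \<open>l * a < s\<close>.\<close>
  then obtain s where s: "l * a < s" "s < - ln p" using dense by blast
  have "0 < l * a" using l a by simp
  have "exp (ln p) < exp (- s)" unfolding exp_less_cancel_iff using s(2) by linarith
  then have "p < exp (- s)" using p by simp
  then have "eventually (\<lambda>n. (\<Sum>v\<in>memory_window (macro_j \<theta>) n. real v powr (l - 1))
      \<le> exp (- s) * real (card (memory_window (macro_j \<theta>) n)) * real (Suc n) powr (l - 1)) sequentially"
    unfolding p_def by (rule window_average[OF \<theta> l(1)])
  then obtain n\<^sub>0 where n0: "\<And>n. n\<^sub>0 \<le> n \<Longrightarrow> (\<Sum>v\<in>memory_window (macro_j \<theta>) n. real v powr (l - 1))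
      \<le> exp (- s) * real (card (memory_window (macro_j \<theta>) n)) * real (Suc n) powr (l - 1)"
    by (auto simp: eventually_sequentially)
  show ?thesis
  proof (rule AE_depth_less[where n\<^sub>0 = "max 1 n\<^sub>0" and l = l and s = s])
    show "memory_window j n \<noteq> {}" if "n \<ge> 1" for n
      using memory_window_macro_nonempty[OF \<theta> that] by (simp only: j not_False_eq_True)
    show "(\<Sum>v\<in>memory_window j n. real v powr (l - 1))
        \<le> exp (- s) * real (card (memory_window j n)) * real (Suc n) powr (l - 1)" if "max 1 n\<^sub>0 \<le> n" for n
      unfolding j using that by (intro n0) simp
  qed (use l s \<open>0 < l * a\<close> in auto)
qed

end

section \<open>Large coefficients in powers of a polynomial\<close>

lemma coeff_power_nonneg:
  fixes P :: "real poly"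
  assumes "\<And>l. 0 \<le> coeff P l"
  shows "0 \<le> coeff (P ^ K) m"
  using assms by (induction K arbitrary: m) (auto simp: coeff_mult intro!: sum_nonneg)

lemma coeff_power_eq_0_below:
  fixes P :: "real poly"
  assumes "coeff P 0 = 0" "q < k"
  shows "coeff (P ^ k) q = 0"
  using assms(2)
proof (induction k arbitrary: q)
  case (Suc k)
  have "coeff P l * coeff (P ^ k) (q - l) = 0" if "l \<le> q" for l
    using assms(1) Suc.IH[of "q - l"] Suc.prems that by (cases "l = 0") auto
  then show ?case by (simp add: coeff_mult sum.neutral)
qed auto

lemma coeff_power_eq_0_above:
  fixes P :: "real poly"
  assumes "k * degree P < q"
  shows "coeff (P ^ k) q = 0"
  using degree_power_le[of P k] assms by (intro coeff_eq_0) (simp add: mult.commute)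

lemma poly_power_eq_sum:
  fixes P :: "real poly"
  shows "(\<Sum>m\<le>K * degree P. coeff (P ^ K) m * exp t ^ m) = poly P (exp t) ^ K"
proof -
  have "poly P (exp t) ^ K = (\<Sum>m\<le>degree (P ^ K). coeff (P ^ K) m * exp t ^ m)"
    by (metis poly_altdef poly_power)
  also have "\<dots> = (\<Sum>m\<le>K * degree P. coeff (P ^ K) m * exp t ^ m)"
    using degree_power_le[of P K] by (intro sum.mono_neutral_left) (auto simp: coeff_eq_0 mult.commute)
  finally show ?thesis ..
qed

text \<open>
  Exponential Markov inequality for the weights \<open>coeff (P ^ K) m * exp t ^ m\<close>: on \<open>S\<close> the weight with
  parameter \<open>t\<close> is at most \<open>exp (c * (t - u)) ^ K\<close> times the weight with parameter \<open>u\<close>. The condition on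
  \<open>S\<close> says \<open>m \<ge> c K\<close> for \<open>u > t\<close> and \<open>m \<le> c K\<close> for \<open>u < t\<close>, so that both tails are covered.
\<close>
lemma coeff_power_chernoff:
  fixes P :: "real poly"
  assumes nn: "\<And>l. 0 \<le> coeff P l"
    and S: "S \<subseteq> {..K * degree P}" "\<And>m. m \<in> S \<Longrightarrow> (t - u) * m \<le> (t - u) * (c * K)"
  shows "(\<Sum>m\<in>S. coeff (P ^ K) m * exp t ^ m) \<le> (poly P (exp u) * exp (c * (t - u))) ^ K"
proof -
  have "(\<Sum>m\<in>S. coeff (P ^ K) m * exp t ^ m) \<le> (\<Sum>m\<in>S. coeff (P ^ K) m * exp u ^ m * exp (c * (t - u)) ^ K)"
  proof (rule sum_mono)
    fix m assume m: "m \<in> S"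
    have "exp t ^ m = exp u ^ m * exp ((t - u) * m)"
      by (simp flip: exp_of_nat_mult exp_add add: algebra_simps)
    also have "\<dots> \<le> exp u ^ m * exp ((t - u) * (c * K))"
      using S(2)[OF m] by (intro mult_left_mono) auto
    also have "exp ((t - u) * (c * K)) = exp (c * (t - u)) ^ K"
      by (simp flip: exp_of_nat_mult add: algebra_simps)
    finally show "coeff (P ^ K) m * exp t ^ m \<le> coeff (P ^ K) m * exp u ^ m * exp (c * (t - u)) ^ K"
      using coeff_power_nonneg[OF nn] by (simp add: mult.assoc mult_left_mono)
  qed
  also have "\<dots> \<le> (\<Sum>m\<le>K * degree P. coeff (P ^ K) m * exp u ^ m * exp (c * (t - u)) ^ K)"
    using S coeff_power_nonneg[OF nn] by (intro sum_mono2) auto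
  also have "\<dots> = poly P (exp u) ^ K * exp (c * (t - u)) ^ K"
    by (simp flip: sum_distrib_right add: poly_power_eq_sum)
  finally show ?thesis by (simp add: power_mult_distrib)
qed

text \<open>
  The lower bound of Cramer's theorem. Let \<open>t0 \<le> 0\<close> minimise \<open>F b t = poly P (exp t) * exp (- b * t)\<close> over
  \<open>t \<le> 0\<close>. If \<open>t0 < 0\<close>, the derivative vanishes at \<open>t0\<close>, which means that the tilted weights
  \<open>coeff (P ^ K) m * exp t0 ^ m\<close> concentrate on degrees \<open>m\<close> near \<open>b K\<close>. These weights sum up to
  \<open>poly P (exp t0) ^ K\<close> and are spread over linearly many degrees, so some coefficient with \<open>m\<close> near
  \<open>b K\<close> is about as large as \<open>F b t0 ^ K \<ge> \<rho> ^ K\<close>. If the minimum is attained at the boundary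
  \<open>t0 = 0\<close>, only the degrees above \<open>b' K\<close> have to be discarded, since the weights are the coefficients
  themselves.
\<close>
lemma exists_coeff_power_gt_1:
  fixes P :: "real poly"
  assumes nn: "\<And>l. 0 \<le> coeff P l" and P1: "0 < coeff P 1"
    and b: "1 < b" "b < b'" and rho: "1 < \<rho>"
    and F: "\<And>t. t \<le> 0 \<Longrightarrow> \<rho> \<le> poly P (exp t) * exp (- b * t)"
  obtains K m where "0 < K" "real m \<le> b' * real K" "1 < coeff (P ^ K) m"
proof -
  define F where "F c t = poly P (exp t) * exp (- c * t)" for c t
  have Ppos: "0 < poly P (exp t)" for t
  proof -
    have "0 < coeff P 1 * exp t ^ 1" using P1 by simp
    also have "\<dots> \<le> (\<Sum>l\<le>degree P. coeff P l * exp t ^ l)"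
      using P1 nn le_degree[of P 1] by (intro member_le_sum) (auto intro: mult_nonneg_nonneg)
    finally show ?thesis by (simp add: poly_altdef)
  qed
  have Plin: "coeff P 1 * exp t \<le> poly P (exp t)" for t
  proof -
    have "coeff P 1 * exp t ^ 1 \<le> (\<Sum>l\<le>degree P. coeff P l * exp t ^ l)"
      using P1 nn le_degree[of P 1] by (intro member_le_sum) (auto intro: mult_nonneg_nonneg)
    then show ?thesis by (simp add: poly_altdef)
  qed
  have dF: "\<exists>D. (F b has_real_derivative D) (at t)" for t
    unfolding F_def by (rule exI) (auto intro!: derivative_eq_intros poly_DERIV[THEN DERIV_chain2])
  have Fshift: "F (b + e) t = F b t * exp (- e * t)" for e t
    by (simp add: F_def algebra_simps exp_add exp_diff exp_minus divide_simps)
  \<comment> \<open>The linear coefficient makes \<open>F b\<close> tend to infinity at \<open>-\<infinity>\<close> because \<open>b > 1\<close>, so a minimiser over a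
    compact interval is a minimiser over the half-line.\<close>
  obtain t0 where t0: "t0 \<le> 0" "\<And>t. t \<le> 0 \<Longrightarrow> F b t0 \<le> F b t"
  proof -
    define T where "T = \<bar>ln (F b 0 / coeff P 1)\<bar> / (b - 1)"
    have "T \<ge> 0" using b by (simp add: T_def)
    have "continuous_on {-T..0} (F b)" using dF by (meson DERIV_isCont continuous_at_imp_continuous_on)
    then obtain s where s: "s \<in> {-T..0}" "\<And>t. t \<in> {-T..0} \<Longrightarrow> F b s \<le> F b t"
      using continuous_attains_inf[of "{-T..0}" "F b"] \<open>T \<ge> 0\<close> by auto
    have "F b s \<le> F b t" if "t \<le> 0" for t
    proof (cases "t \<ge> -T")
      case False
      have "ln (F b 0 / coeff P 1) \<le> T * (b - 1)" using b by (simp add: T_def)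
      also have "\<dots> \<le> (1 - b) * t" using False b mult_right_mono[of T "-t" "b - 1"] by (simp add: algebra_simps)
      finally have "F b 0 / coeff P 1 \<le> exp ((1 - b) * t)"
        using Ppos[of 0] P1 exp_le_cancel_iff[of "ln (F b 0 / coeff P 1)"] by (simp add: F_def)
      also have "exp ((1 - b) * t) = exp t * exp (- b * t)"
        by (simp add: algebra_simps flip: exp_add)
      finally have "F b 0 \<le> coeff P 1 * exp t * exp (- b * t)"
        using P1 by (simp add: field_simps)
      also have "\<dots> \<le> F b t" unfolding F_def using Plin by (intro mult_right_mono) auto
      finally show ?thesis using s(2)[of 0] \<open>T \<ge> 0\<close> by simp
    qed (use s that in auto)
    with s that show thesis by auto
  qed
  define p where "p = poly P (exp t0)"
  have "p > 0" using Ppos by (simp add: p_def)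
  obtain D where D: "(F b has_real_derivative D) (at t0)" using dF by blast
  have "D \<le> 0"
  proof (rule ccontr)
    assume "\<not> D \<le> 0"
    then obtain d where "d > 0" "\<And>h. 0 < h \<Longrightarrow> h < d \<Longrightarrow> F b (t0 - h) < F b t0"
      using DERIV_pos_inc_left[OF D] by auto
    from this(1) this(2)[of "d/2"] t0(2)[of "t0 - d/2"] t0(1) show False by auto
  qed
  have D0: "D = 0" if "t0 < 0"
  proof (rule ccontr)
    assume "D \<noteq> 0"
    then obtain d where d: "d > 0" "\<And>h. 0 < h \<Longrightarrow> h < d \<Longrightarrow> F b (t0 + h) < F b t0"
      using DERIV_neg_dec_right[OF D] \<open>D \<le> 0\<close> by auto
    define h where "h = min (d/2) (- t0)"
    have "0 < h" "h < d" "t0 + h \<le> 0" using d(1) that by (auto simp: h_def)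
    then show False using d(2)[of h] t0(2)[of "t0 + h"] by auto
  qed
  have F0: "\<rho> \<le> F b t0" using F[OF t0(1)] by (simp add: F_def)
  have dFe: "(F (b + e) has_real_derivative exp (- e * t0) * (D - e * F b t0)) (at t0)" for e
    unfolding Fshift[abs_def]
    by (auto intro!: derivative_eq_intros D simp: algebra_simps)
  have conv: "poly P (exp u) * exp (c * (t0 - u)) = F c u / F c t0 * p" for u c
    using Ppos[of t0] by (simp add: F_def p_def exp_diff exp_minus divide_simps algebra_simps)
  \<comment> \<open>Increasing \<open>b\<close> to \<open>b'\<close> makes the derivative at \<open>t0\<close> negative, so a parameter \<open>u > t0\<close> gives an exponentially
    small bound for the degrees above \<open>b' K\<close>.\<close>
  obtain r1 where r1: "0 \<le> r1" "r1 < 1" and tail: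
    "\<And>K. (\<Sum>m | m \<le> K * degree P \<and> b' * K < m. coeff (P ^ K) m * exp t0 ^ m) \<le> (r1 * p) ^ K"
  proof -
    have "0 < (b' - b) * F b t0" using F0 b rho by (intro mult_pos_pos) linarith+
    then have "exp (- (b' - b) * t0) * (D - (b' - b) * F b t0) < 0"
      using \<open>D \<le> 0\<close> by (intro mult_pos_neg exp_gt_zero) linarith
    then obtain d where d: "d > 0" "\<And>h. 0 < h \<Longrightarrow> h < d \<Longrightarrow> F b' (t0 + h) < F b' t0"
      using DERIV_neg_dec_right[OF dFe[of "b' - b"]] by auto
    define u where "u = t0 + d/2"
    have u: "t0 < u" "F b' u < F b' t0" using d(1) d(2)[of "d/2"] by (auto simp: u_def)
    have pos: "0 < F b' t" for t using Ppos by (simp add: F_def)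
    show thesis
    proof (rule that[of "F b' u / F b' t0"])
      fix K
      have "(\<Sum>m | m \<le> K * degree P \<and> b' * K < m. coeff (P ^ K) m * exp t0 ^ m)
        \<le> (poly P (exp u) * exp (b' * (t0 - u))) ^ K"
        using u by (intro coeff_power_chernoff nn) (auto intro!: mult_left_mono_neg)
      then show "(\<Sum>m | m \<le> K * degree P \<and> b' * K < m. coeff (P ^ K) m * exp t0 ^ m) \<le> (F b' u / F b' t0 * p) ^ K"
        by (simp only: conv)
    qed (use u pos in \<open>auto intro: less_imp_le\<close>)
  qed
  \<comment> \<open>The degrees below \<open>\<beta> K\<close> are negligible as well, while degrees from \<open>\<beta> K\<close> on have
    \<open>exp t0 ^ m \<le> exp (\<beta> * t0) ^ K\<close>, which loses little: \<open>\<beta>\<close> is so close to \<open>b\<close> that \<open>p * exp (- \<beta> * t0)\<close>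
    still exceeds \<open>1\<close>. For \<open>t0 = 0\<close> the choice \<open>\<beta> = 0\<close> works.\<close>
  obtain r2 \<beta> \<rho>' where r2: "0 \<le> r2" "r2 < 1" and rho': "1 < \<rho>'" "\<rho>' \<le> p * exp (- \<beta> * t0)" and head:
    "\<And>K. (\<Sum>m | m \<le> K * degree P \<and> m < \<beta> * K. coeff (P ^ K) m * exp t0 ^ m) \<le> (r2 * p) ^ K"
  proof (cases "t0 = 0")
    case True
    show thesis
    proof (rule that[of 0 \<rho> 0])
      show "\<rho> \<le> p * exp (- 0 * t0)" using F0 True by (simp add: F_def p_def)
    qed (use rho \<open>p > 0\<close> in \<open>auto simp: power_0_left\<close>)
  next
    case False
    then have neg: "t0 < 0" using t0 by simp
    \<comment> \<open>This \<open>e\<close> makes \<open>exp (e * t0)\<close> the inverse square root of \<open>\<rho>\<close>, half of the available gain.\<close>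
    define e where "e = ln \<rho> / (2 * (- t0))"
    have e: "e > 0" using neg rho by (auto simp: e_def intro!: divide_pos_neg)
    have e2: "e * t0 = - ln \<rho> / 2" using neg by (simp add: e_def)
    have "exp (- (- e) * t0) * (D - (- e) * F b t0) > 0"
      using D0[OF neg] F0 rho e by (intro mult_pos_pos exp_gt_zero) simp
    then obtain d where d: "d > 0" "\<And>h. 0 < h \<Longrightarrow> h < d \<Longrightarrow> F (b - e) (t0 - h) < F (b - e) t0"
      using DERIV_pos_inc_left[OF dFe[of "- e"]] by auto
    define u where "u = t0 - d/2"
    have u: "u < t0" "F (b - e) u < F (b - e) t0" using d(1) d(2)[of "d/2"] by (auto simp: u_def)
    have pos: "0 < F (b - e) t" for t using Ppos by (simp add: F_def)
    show thesis
    proof (rule that[of "F (b - e) u / F (b - e) t0" "exp (ln \<rho> / 2)" "b - e"])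
      have "exp (ln \<rho> / 2) = \<rho> * exp (e * t0)" unfolding e2 using rho
        exp_add[of "ln \<rho>" "- ln \<rho> / 2"] by simp
      also have "\<dots> \<le> F b t0 * exp (e * t0)" using F0 by simp
      also have "\<dots> = p * exp (- (b - e) * t0)" by (simp add: F_def p_def algebra_simps flip: exp_add)
      finally show "exp (ln \<rho> / 2) \<le> p * exp (- (b - e) * t0)" .
      fix K
      have "(\<Sum>m | m \<le> K * degree P \<and> m < (b - e) * K. coeff (P ^ K) m * exp t0 ^ m)
        \<le> (poly P (exp u) * exp ((b - e) * (t0 - u))) ^ K"
        using u by (intro coeff_power_chernoff nn) (auto intro!: mult_left_mono)
      then show "(\<Sum>m | m \<le> K * degree P \<and> m < (b - e) * K. coeff (P ^ K) m * exp t0 ^ m) \<le> (F (b - e) u / F (b - e) t0 * p) ^ K"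
        by (simp only: conv)
    qed (use u pos rho in \<open>auto intro: less_imp_le\<close>)
  qed
  have "eventually (\<lambda>K. r1 ^ K < 1/4 \<and> r2 ^ K < 1/4 \<and> 2 * (real K * real (degree P) + 1) < \<rho>' ^ K \<and> 0 < K) sequentially"
  proof (intro eventually_conj)
    show "eventually (\<lambda>K. r1 ^ K < 1/4) sequentially" "eventually (\<lambda>K. r2 ^ K < 1/4) sequentially"
      by (rule order_tendstoD(2)[OF LIMSEQ_power_zero]; use r1 r2 in simp)+
    show "eventually (\<lambda>K. 2 * (real K * real (degree P) + 1) < \<rho>' ^ K) sequentially"
      using rho'(1) by real_asymp
  qed (rule eventually_gt_at_top)
  then obtain K where K: "r1 ^ K < 1/4" "r2 ^ K < 1/4" "2 * (real K * real (degree P) + 1) < \<rho>' ^ K" "0 < K"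
    by (auto simp: eventually_sequentially)
  have "\<exists>m. real m \<le> b' * K \<and> 1 < coeff (P ^ K) m"
  proof (rule ccontr)
    assume "\<not> ?thesis"
    then have small: "coeff (P ^ K) m \<le> 1" if "real m \<le> b' * K" for m using that by force
    let ?f = "\<lambda>m. coeff (P ^ K) m * exp t0 ^ m"
    have f_nn: "0 \<le> ?f m" for m using coeff_power_nonneg[OF nn] by simp
    let ?A = "{m. m \<le> K * degree P \<and> b' * K < m}" and ?B = "{m. m \<le> K * degree P \<and> m < \<beta> * K}"
    let ?C = "{m. m \<le> K * degree P \<and> \<beta> * K \<le> m \<and> m \<le> b' * K}"
    have "p ^ K = sum ?f {..K * degree P}" by (simp add: poly_power_eq_sum p_def)
    also have "\<dots> \<le> sum ?f (?A \<union> ?B \<union> ?C)"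
      by (intro sum_mono2) (auto intro!: f_nn)
    also have "\<dots> \<le> sum ?f (?A \<union> ?B) + sum ?f ?C"
      by (subst sum_Un) (auto intro!: sum_nonneg f_nn)
    also have "sum ?f (?A \<union> ?B) \<le> sum ?f ?A + sum ?f ?B"
      by (subst sum_Un) (auto intro!: sum_nonneg f_nn)
    also have "sum ?f ?A \<le> (r1 * p) ^ K" by (rule tail)
    also have "sum ?f ?B \<le> (r2 * p) ^ K" by (rule head)
    also have "sum ?f ?C \<le> (\<Sum>m\<in>?C. exp (\<beta> * t0 * K))"
    proof (rule sum_mono)
      fix m assume m: "m \<in> ?C"
      have "?f m \<le> 1 * exp t0 ^ m" using m small by (intro mult_right_mono) auto
      also have "\<dots> = exp (t0 * m)" by (simp flip: exp_of_nat_mult add: mult.commute)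
      also have "\<dots> \<le> exp (\<beta> * t0 * K)"
        using m mult_left_mono_neg[of "\<beta> * K" "real m" t0] t0(1) by (simp add: algebra_simps)
      finally show "?f m \<le> exp (\<beta> * t0 * K)" .
    qed
    also have "\<dots> = card ?C * exp (\<beta> * t0) ^ K" by (simp flip: exp_of_nat_mult add: algebra_simps)
    also have "\<dots> \<le> (real K * real (degree P) + 1) * exp (\<beta> * t0) ^ K"
    proof (rule mult_right_mono)
      have "card ?C \<le> card {..K * degree P}" by (intro card_mono) auto
      then show "real (card ?C) \<le> real K * real (degree P) + 1" by (simp flip: of_nat_mult of_nat_Suc)
    qed auto
    also have "\<dots> < \<rho>' ^ K / 2 * exp (\<beta> * t0) ^ K" using K by (intro mult_strict_right_mono) auto
    also have "\<dots> = (\<rho>' * exp (\<beta> * t0)) ^ K / 2" by (simp add: power_mult_distrib)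
    also have "\<dots> \<le> p ^ K / 2"
    proof (intro divide_right_mono power_mono)
      show "\<rho>' * exp (\<beta> * t0) \<le> p" using rho' by (simp add: exp_minus field_simps)
    qed (use rho' in auto)
    also have "(r1 * p) ^ K + (r2 * p) ^ K + p ^ K / 2 = (r1 ^ K + r2 ^ K + 1/2) * p ^ K"
      by (simp add: power_mult_distrib algebra_simps)
    also have "\<dots> < 1 * p ^ K" using K \<open>p > 0\<close> by (intro mult_strict_right_mono) auto
    finally show False by simp
  qed
  with K that show thesis by blast
qed

section \<open>Populations that dominate a supercritical linear recursion\<close>

text \<open>
  Here \<open>N i k\<close> stands for the number of vertices of depth at least \<open>k\<close> in block \<open>i\<close>. A population \<open>A\<close>
  in block \<open>i\<close> produces at least \<open>A * coeff (P ^ r) q\<close> descendants \<open>r\<close> generations and \<open>q\<close> blocks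
  later, because the convolution with the coefficients of \<open>P\<close> in the recursion is multiplication by \<open>P\<close>.
  The recursion is only available while its right-hand side exceeds the block index. Hypothesis \<open>large\<close>
  ensures this wherever the predicted number is not zero. Since \<open>coeff P 0 = 0\<close>, each generation moves at
  least one block ahead, which keeps \<open>k \<le> i\<close>.
\<close>
lemma descendants_ge_coeff_power:
  fixes P :: "real poly" and N :: "nat \<Rightarrow> nat \<Rightarrow> real"
  assumes nn: "\<And>l. 0 \<le> coeff P l" and P0: "coeff P 0 = 0" and N: "\<And>i k. 0 \<le> N i k"
    and step: "\<And>i k. I \<le> i \<Longrightarrow> k \<le> i \<Longrightarrow> real i \<le> (\<Sum>l\<le>i. coeff P l * N (i - l) k) \<Longrightarrow>
      (\<Sum>l\<le>i. coeff P l * N (i - l) k) \<le> N i (Suc k)"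
    and A: "0 \<le> A" "A \<le> N i k" "I \<le> i" "k \<le> i"
    and large: "\<And>r q. r \<le> K \<Longrightarrow> 0 < coeff (P ^ r) q \<Longrightarrow> real (i + q) \<le> A * coeff (P ^ r) q"
    and "r \<le> K"
  shows "A * coeff (P ^ r) q \<le> N (i + q) (k + r)"
  using \<open>r \<le> K\<close>
proof (induction r arbitrary: q)
  case 0
  then show ?case using A N by (cases q) auto
next
  case (Suc r)
  show ?case
  proof (cases "coeff (P ^ Suc r) q = 0")
    case False
    then have pos: "0 < coeff (P ^ Suc r) q"
      using coeff_power_nonneg[OF nn, of "Suc r" q] by linarith
    have "Suc r \<le> q" using coeff_power_eq_0_below[OF P0, of q "Suc r"] False by force
    have "A * coeff (P ^ Suc r) q = (\<Sum>l\<le>q. coeff P l * (A * coeff (P ^ r) (q - l)))"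
      by (simp add: coeff_mult sum_distrib_left mult_ac)
    also have "\<dots> \<le> (\<Sum>l\<le>q. coeff P l * N (i + q - l) (k + r))"
    proof (rule sum_mono)
      fix l assume "l \<in> {..q}"
      then show "coeff P l * (A * coeff (P ^ r) (q - l)) \<le> coeff P l * N (i + q - l) (k + r)"
        using Suc.IH[of "q - l"] Suc.prems nn by (intro mult_left_mono) auto
    qed
    also have "\<dots> \<le> (\<Sum>l\<le>i + q. coeff P l * N (i + q - l) (k + r))"
      using nn N by (intro sum_mono2) auto
    finally have le: "A * coeff (P ^ Suc r) q \<le> (\<Sum>l\<le>i + q. coeff P l * N (i + q - l) (k + r))" .
    also have "\<dots> \<le> N (i + q) (Suc (k + r))"
      using large[OF Suc.prems pos] le A \<open>Suc r \<le> q\<close> by (intro step) auto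
    finally show ?thesis by simp
  qed (use N in simp)
qed

text \<open>
  After \<open>K\<close> generations and \<open>m\<close> blocks the population is multiplied by \<open>R = coeff (P ^ K) m > 1\<close>. The
  threshold of the recursion grows only linearly in the number of repetitions, so it is met forever if the
  first population is large compared with the index of its block.
\<close>
lemma populations_never_empty:
  fixes P :: "real poly" and N :: "nat \<Rightarrow> nat \<Rightarrow> real"
  assumes nn: "\<And>l. 0 \<le> coeff P l" and P0: "coeff P 0 = 0" and N: "\<And>i k. 0 \<le> N i k"
    and step: "\<And>i k. I\<^sub>0 \<le> i \<Longrightarrow> k \<le> i \<Longrightarrow> real i \<le> (\<Sum>l\<le>i. coeff P l * N (i - l) k) \<Longrightarrow>
      (\<Sum>l\<le>i. coeff P l * N (i - l) k) \<le> N i (Suc k)"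
    and start: "filterlim (\<lambda>i. N i 0 / real i) at_top at_top"
    and R: "1 < coeff (P ^ K) m"
  shows "\<exists>I. \<forall>j. 0 < N (I + j * m) (j * K)"
proof -
  define R where "R = coeff (P ^ K) m"
  let ?d = "K * degree P"
  \<comment> \<open>A lower bound \<open>c\<close> for all positive coefficients controls the populations between two repetitions.\<close>
  define S where "S = {coeff (P ^ r) q | r q. r \<in> {..K} \<and> q \<in> {..?d} \<and> 0 < coeff (P ^ r) q}"
  have "S \<subseteq> (\<lambda>(r, q). coeff (P ^ r) q) ` ({..K} \<times> {..?d})" unfolding S_def by auto
  then have fin: "finite S" by (rule finite_subset) auto
  define c where "c = Min (insert 1 S)"
  have c: "0 < c" using fin by (auto simp: c_def S_def)
  have c_le: "c \<le> coeff (P ^ r) q \<and> q \<le> ?d" if "r \<le> K" "0 < coeff (P ^ r) q" for r q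
  proof -
    have "q \<le> r * degree P" using coeff_power_eq_0_above[of r P q] that by force
    also have "\<dots> \<le> ?d" using that by simp
    finally show ?thesis using that fin by (auto simp: c_def S_def intro!: Min_le)
  qed
  have "m \<ge> K" "m \<le> ?d"
    using R coeff_power_eq_0_below[OF P0, of m K] coeff_power_eq_0_above[of K P m] by force+
  have "(\<lambda>j. (real j + 2) / R ^ j) \<longlonglongrightarrow> 0" using R unfolding R_def[symmetric] by real_asymp
  then have "Bseq (\<lambda>j. (real j + 2) / R ^ j)" by (rule convergentI[THEN convergent_imp_Bseq])
  then obtain B where B: "B > 0" "\<And>j. norm ((real j + 2) / R ^ j) \<le> B" by (auto elim: BseqE)
  \<comment> \<open>The bound \<open>I * (j + 2)\<close> for the block indices within the repetition \<open>j\<close> explains the summand \<open>2\<close>.\<close>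
  have B': "(real j + 2) \<le> B * R ^ j" for j
    using B(2)[of j] R by (simp add: R_def field_simps)
  have "eventually (\<lambda>i. B / c \<le> N i 0 / real i \<and> I\<^sub>0 + ?d + 1 \<le> i) sequentially"
    using start by (intro eventually_conj eventually_ge_at_top) (auto simp: filterlim_at_top)
  then obtain I where I: "B / c \<le> N I 0 / real I" "I\<^sub>0 + ?d + 1 \<le> I"
    by (auto simp: eventually_sequentially)
  define A where "A = N I 0"
  have A: "B * real I \<le> A * c" using I c by (simp add: A_def field_simps)
  have "0 < B * real I" using B I by simp
  with A c have "0 < A" by (metis less_le_trans zero_less_mult_pos2)
  have main: "A * R ^ j \<le> N (I + j * m) (j * K)" for j
  proof (induction j)
    case 0
    then show ?case by (simp add: A_def)
  next
    case (Suc j)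
    have "A * R ^ j * coeff (P ^ K) m \<le> N (I + j * m + m) (j * K + K)"
    proof (rule descendants_ge_coeff_power[where K = K])
      show "real i \<le> (\<Sum>l\<le>i. coeff P l * N (i - l) k) \<Longrightarrow>
          (\<Sum>l\<le>i. coeff P l * N (i - l) k) \<le> N i (Suc k)" if "I \<le> i" "k \<le> i" for i k
        using step[of i k] that I by auto
      show "0 \<le> A * R ^ j" using \<open>0 < A\<close> R by (simp add: R_def)
      show "j * K \<le> I + j * m" using \<open>m \<ge> K\<close> by (simp add: trans_le_add2)
      fix r q assume rq: "r \<le> K" "0 < coeff (P ^ r) q"
      have "I + j * m + q \<le> I * (j + 2)"
      proof -
        have "m \<le> I" "q \<le> I" using c_le[OF rq] \<open>m \<le> ?d\<close> I by linarith+
        moreover from this(1) have "j * m \<le> j * I" by (rule mult_le_mono2)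
        moreover have "I * (j + 2) = I + j * I + I" by simp
        ultimately show ?thesis by linarith
      qed
      then have "real (I + j * m + q) \<le> real (I * (j + 2))" by (simp only: of_nat_le_iff)
      also have "\<dots> = real I * (real j + 2)" by (simp add: algebra_simps)
      also have "\<dots> \<le> real I * (B * R ^ j)" by (intro mult_left_mono B') auto
      also have "\<dots> = (B * real I) * R ^ j" by simp
      also have "\<dots> \<le> A * c * R ^ j" using A R by (intro mult_right_mono) (auto simp: R_def)
      also have "\<dots> = A * R ^ j * c" by simp
      also have "\<dots> \<le> A * R ^ j * coeff (P ^ r) q"
        using c_le[OF rq] \<open>0 < A\<close> R by (intro mult_left_mono) (auto simp: R_def)
      finally show "real (I + j * m + q) \<le> A * R ^ j * coeff (P ^ r) q" .
    qed (use nn P0 N Suc.IH in auto)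
    then show ?case by (simp add: R_def algebra_simps)
  qed
  have "0 < N (I + j * m) (j * K)" for j
    using main[of j] mult_pos_pos[OF \<open>0 < A\<close>, of "R ^ j"] R by (simp add: R_def)
  then show ?thesis by blast
qed

section \<open>Discretisation into blocks\<close>

lemma geometric_sum_lower:
  fixes x :: real
  assumes "0 < x" "x \<le> 1"
  shows "real L * (\<Sum>i<Suc L. x ^ i) \<le> real (Suc L) * (\<Sum>i<L. x ^ i)"
proof -
  have "(\<Sum>i<L. x ^ L) \<le> (\<Sum>i<L. x ^ i)" using assms by (intro sum_mono power_decreasing) auto
  then show ?thesis by (simp add: algebra_simps)
qed

text \<open>
  A Riemann sum comparison between \<open>\<phi>\<close> and its discretisation with step \<open>\<delta>\<close>: with
  \<open>x = exp (- s * \<delta>)\<close> one has \<open>x ^ (L + 1) = \<theta> powr s\<close>, so the geometric sum over \<open>L + 1\<close> terms is at least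
  \<open>(1 - \<theta> powr s) / (s * \<delta>)\<close>. Dropping the last, smallest term costs at most the factor \<open>L / (L + 1)\<close>.
\<close>
lemma block_sum_lower:
  fixes \<theta> s :: real and L :: nat
  assumes "0 < \<theta>" "\<theta> < 1" "0 < s" "1 \<le> L"
  defines "\<delta> \<equiv> ln (1 / \<theta>) / real (Suc L)"
  shows "(real L / real (Suc L)) * exp (- s * \<delta>) * ((1 - \<theta>) * lm_phi \<theta> s) \<le> \<delta> * (\<Sum>l=1..L. exp (- s * \<delta>) ^ l)"
proof -
  define x where "x = exp (- s * \<delta>)"
  have \<delta>: "0 < \<delta>" using assms by (simp add: \<delta>_def)
  have x: "0 < x" "x < 1" using \<delta> assms by (auto simp: x_def)
  have "1 - x \<le> s * \<delta>" using exp_ge_add_one_self[of "- s * \<delta>"] by (simp add: x_def)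
  have "x ^ Suc L = exp (- s * (\<delta> * real (Suc L)))"
    unfolding x_def by (simp only: exp_of_nat_mult[symmetric] mult_ac)
  also have "\<delta> * real (Suc L) = - ln \<theta>" using assms by (simp add: \<delta>_def ln_div)
  also have "exp (- s * - ln \<theta>) = \<theta> powr s" using assms by (simp add: powr_def)
  finally have xL: "x ^ Suc L = \<theta> powr s" .
  have "1 - \<theta> powr s = (1 - x) * (\<Sum>i<Suc L. x ^ i)" unfolding xL[symmetric] by (rule one_diff_power_eq)
  also have "\<dots> \<le> s * \<delta> * (\<Sum>i<Suc L. x ^ i)"
    using \<open>1 - x \<le> _\<close> x by (intro mult_right_mono sum_nonneg) auto
  finally have *: "(1 - \<theta> powr s) / s \<le> \<delta> * (\<Sum>i<Suc L. x ^ i)"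
    using assms by (simp add: field_simps)
  have "(real L / real (Suc L)) * x * ((1 - \<theta>) * lm_phi \<theta> s) = (real L / real (Suc L)) * x * ((1 - \<theta> powr s) / s)"
    using assms by (simp add: lm_phi_def)
  also have "\<dots> \<le> (real L / real (Suc L)) * x * (\<delta> * (\<Sum>i<Suc L. x ^ i))"
    using * x by (intro mult_left_mono) auto
  also have "\<dots> = \<delta> * x * ((real L * (\<Sum>i<Suc L. x ^ i)) / real (Suc L))" by simp
  also have "\<dots> \<le> \<delta> * x * (\<Sum>i<L. x ^ i)"
    using geometric_sum_lower[of x L] x \<delta> by (intro mult_left_mono) (auto simp: divide_le_eq mult.commute)
  also have "\<dots> = \<delta> * (\<Sum>i<L. x ^ Suc i)" by (simp add: sum_distrib_left mult_ac)
  also have "(\<Sum>i<L. x ^ Suc i) = (\<Sum>l=1..L. x ^ l)"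
    by (rule sum.reindex_bij_witness[of _ "\<lambda>l. l - 1" Suc]) auto
  finally show ?thesis by (simp add: x_def)
qed

text \<open>
  For \<open>t = - s * \<delta>\<close> the claim is a uniform version of \<open>\<phi>(s) * exp (a * s) > 1\<close> for \<open>s \<ge> 0\<close>, with the
  factor \<open>q L\<close>, which tends to \<open>1\<close>, for the losses of the discretisation. For \<open>s > 1\<close> this comes from
  \<open>a > \<kappa>\<close>. For \<open>s \<le> 1\<close> it follows from the monotonicity of the discretised \<open>\<phi>\<close>:
  \<open>\<phi>(1) = 1\<close> and the gain is at least \<open>exp (a / 2)\<close> for \<open>1/2 \<le> s \<le> 1\<close>, and \<open>\<phi>(1/2) = 2 / (1 + sqrt \<theta>)\<close> exceeds
  \<open>1\<close> by itself for \<open>s \<le> 1/2\<close>.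
\<close>
lemma blocks_supercritical:
  fixes \<theta> a :: real
  assumes \<theta>: "0 < \<theta>" "\<theta> < 1" and a: "lm_kappa \<theta> < a"
  obtains L :: nat and \<delta> w \<rho> :: real where "1 \<le> L" "\<delta> = ln (1 / \<theta>) / real (Suc L)" "0 < \<delta>" "\<delta> < a"
    "0 < w" "w < (1 - exp (- \<delta>)) / (1 - \<theta>)" "1 < \<rho>"
    "\<And>t. t \<le> 0 \<Longrightarrow> \<rho> \<le> w * (\<Sum>l=1..L. exp t ^ l) * exp (- (a / \<delta>) * t)"
proof -
  define a' where "a' = (lm_kappa \<theta> + a) / 2"
  have a': "lm_kappa \<theta> < a'" "a' < a" using a by (auto simp: a'_def)
  have "a > 0" using lm_kappa_pos[OF \<theta>] a by simp
  define T where "T = ln (1 / \<theta>)"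
  have "T > 0" using \<theta> by (simp add: T_def)
  define c where "c = min (exp (a - a')) (min (exp (a / 2)) (2 / (1 + sqrt \<theta>)))"
  have "sqrt \<theta> < 1" "0 < sqrt \<theta>" using \<theta> by auto
  then have "1 + sqrt \<theta> < 2" "0 < 1 + sqrt \<theta>" by linarith+
  then have "1 < 2 / (1 + sqrt \<theta>)" by (simp add: less_divide_eq)
  then have "1 < c" using a' \<open>a > 0\<close> by (auto simp: c_def)
  define q where "q L = (real L / real (Suc L)) ^ 2 * exp (- (T / real (Suc L))) * exp (- (T / real (Suc L)))" for L
  have "q \<longlonglongrightarrow> 1" unfolding q_def[abs_def] by real_asymp
  then have "(\<lambda>L. q L * c) \<longlonglongrightarrow> 1 * c" by (intro tendsto_intros)
  then have "eventually (\<lambda>L. 1 < q L * c) sequentially" using \<open>1 < c\<close> by (auto dest: order_tendstoD)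
  moreover have "(\<lambda>L. T / real (Suc L)) \<longlonglongrightarrow> 0" by real_asymp
  then have "eventually (\<lambda>L. T / real (Suc L) < min a (a - a')) sequentially"
    using a' \<open>a > 0\<close> by (intro order_tendstoD(2)) auto
  ultimately have "eventually (\<lambda>L. 1 < q L * c \<and> T / real (Suc L) < min a (a - a') \<and> 1 \<le> L) sequentially"
    by (intro eventually_conj eventually_ge_at_top)
  then obtain L where L: "1 < q L * c" "T / real (Suc L) < min a (a - a')" "1 \<le> L"
    by (auto simp: eventually_sequentially)
  define \<delta> where "\<delta> = T / real (Suc L)"
  have \<delta>: "0 < \<delta>" "\<delta> < a" "\<delta> < a - a'" using L \<open>T > 0\<close> by (auto simp: \<delta>_def)
  define w where "w = (real L / real (Suc L)) * ((1 - exp (- \<delta>)) / (1 - \<theta>))"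
  have w0: "0 < (1 - exp (- \<delta>)) / (1 - \<theta>)" using \<delta> \<theta> by simp
  have w: "0 < w" "w < (1 - exp (- \<delta>)) / (1 - \<theta>)"
    using mult_strict_right_mono[of "real L / real (Suc L)" 1, OF _ w0] mult_pos_pos[OF _ w0, of "real L / real (Suc L)"] L
    by (simp_all add: w_def)
  define f where "f s = w * (\<Sum>l=1..L. exp (- s * \<delta>) ^ l)" for s
  have f_mono: "f \<mu> \<le> f s" if "s \<le> \<mu>" for s \<mu>
    unfolding f_def using that w \<delta> by (intro mult_left_mono sum_mono power_mono) auto
  have f_lower: "q L * exp \<delta> * exp (- s * \<delta>) * lm_phi \<theta> s \<le> f s" if "0 < s" for s
  proof -
    have "\<delta> * exp (- \<delta>) \<le> 1 - exp (- \<delta>)"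
      using exp_ge_add_one_self[of \<delta>] by (simp add: exp_minus field_simps)
    then have "(real L / real (Suc L)) * (\<delta> * exp (- \<delta>) / (1 - \<theta>)) \<le> w"
      unfolding w_def using \<theta> by (intro mult_left_mono divide_right_mono) auto
    then have "(real L / real (Suc L)) * (\<delta> * exp (- \<delta>) / (1 - \<theta>)) * (\<Sum>l=1..L. exp (- s * \<delta>) ^ l) \<le> f s"
      unfolding f_def by (intro mult_right_mono sum_nonneg) auto
    moreover have "(real L / real (Suc L)) * (exp (- \<delta>) / (1 - \<theta>)) *
        ((real L / real (Suc L)) * exp (- s * \<delta>) * ((1 - \<theta>) * lm_phi \<theta> s))
      \<le> (real L / real (Suc L)) * (exp (- \<delta>) / (1 - \<theta>)) * (\<delta> * (\<Sum>l=1..L. exp (- s * \<delta>) ^ l))"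
      using block_sum_lower[OF \<theta> that \<open>1 \<le> L\<close>] \<theta> unfolding \<delta>_def T_def
      by (intro mult_left_mono) auto
    moreover have "(real L / real (Suc L)) * (exp (- \<delta>) / (1 - \<theta>)) *
        ((real L / real (Suc L)) * exp (- s * \<delta>) * ((1 - \<theta>) * lm_phi \<theta> s))
        = q L * exp \<delta> * exp (- s * \<delta>) * lm_phi \<theta> s"
    proof -
      have "q L * exp \<delta> = (real L / real (Suc L)) ^ 2 * exp (- \<delta>)"
        by (simp only: q_def \<delta>_def) (simp add: exp_minus)
      then show ?thesis using \<theta> by (simp only:) (simp add: power2_eq_square)
    qed
    ultimately show ?thesis by (simp add: mult_ac)
  qed
  have q0: "0 \<le> q L" by (simp add: q_def)
  have main: "q L * c \<le> f s * exp (a * s)" if "0 \<le> s" for s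
  proof -
    consider "1 < s" | "1/2 \<le> s" "s \<le> 1" | "s \<le> 1/2" by linarith
    then show ?thesis
    proof cases
      case 1
      have "q L * c \<le> q L * exp (a - a')" using q0 by (intro mult_left_mono) (auto simp: c_def)
      also have "\<dots> \<le> q L * (exp (\<delta> + s * (a - a' - \<delta>)) * (lm_phi \<theta> s * exp (s * a')))"
      proof (rule mult_left_mono[OF _ q0])
        have "1 * (a - a' - \<delta>) \<le> s * (a - a' - \<delta>)" using 1 \<delta> by (intro mult_right_mono) auto
        then have "exp (a - a') * 1 \<le> exp (\<delta> + s * (a - a' - \<delta>)) * (lm_phi \<theta> s * exp (s * a'))"
          using above_lm_kappaD[OF \<theta> a'(1) 1] by (intro mult_mono) auto
        then show "exp (a - a') \<le> exp (\<delta> + s * (a - a' - \<delta>)) * (lm_phi \<theta> s * exp (s * a'))" by simp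
      qed
      also have "exp (\<delta> + s * (a - a' - \<delta>)) * (lm_phi \<theta> s * exp (s * a'))
          = exp \<delta> * exp (- s * \<delta>) * lm_phi \<theta> s * exp (a * s)"
        by (simp add: algebra_simps exp_add exp_diff exp_minus divide_inverse)
      also have "q L * \<dots> = q L * exp \<delta> * exp (- s * \<delta>) * lm_phi \<theta> s * exp (a * s)" by simp
      also have "\<dots> \<le> f s * exp (a * s)" using f_lower 1 by (intro mult_right_mono) auto
      finally show ?thesis .
    next
      case 2
      have "q L * c \<le> q L * exp (a / 2)" using q0 by (intro mult_left_mono) (auto simp: c_def)
      also have "\<dots> = q L * exp \<delta> * exp (- 1 * \<delta>) * lm_phi \<theta> 1 * exp (a / 2)"
        using \<theta> by (simp add: lm_phi_def exp_minus)
      also have "\<dots> \<le> f 1 * exp (a / 2)" using f_lower[of 1] by (intro mult_right_mono) auto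
      also have "\<dots> \<le> f s * exp (a * s)"
        using 2 f_mono[of s 1] \<open>a > 0\<close> w unfolding f_def by (intro mult_mono) (auto intro!: sum_nonneg mult_nonneg_nonneg)
      finally show ?thesis .
    next
      case 3
      have "lm_phi \<theta> (1/2) = 2 / (1 + sqrt \<theta>)"
      proof -
        define u where "u = sqrt \<theta>"
        have u: "0 < u" "u < 1" and "\<theta> = u * u" using \<theta> by (auto simp: u_def)
        then have "1 - \<theta> = (1 - u) * (1 + u)" by (simp add: algebra_simps)
        then have "lm_phi \<theta> (1/2) = (1 - u) / (1/2 * ((1 - u) * (1 + u)))"
          using \<theta> by (simp add: lm_phi_def powr_half_sqrt u_def)
        also have "\<dots> = 2 / (1 + u)" using u mult_strict_mono[of u 1 u 1] by (subst frac_eq_eq) (auto simp: algebra_simps)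
        finally show ?thesis by (simp add: u_def)
      qed
      then have "q L * c \<le> q L * 1 * lm_phi \<theta> (1/2)"
        unfolding mult_1_right using q0 by (intro mult_left_mono) (simp_all add: c_def)
      also have "\<dots> \<le> q L * exp (\<delta> / 2) * lm_phi \<theta> (1/2)"
        using q0 \<delta> lm_phi_pos[OF \<theta>, of "1/2"] by (intro mult_right_mono mult_left_mono) auto
      also have "\<dots> = q L * exp \<delta> * exp (- (1/2) * \<delta>) * lm_phi \<theta> (1/2)"
        by (simp flip: exp_add)
      also have "\<dots> \<le> f (1/2) * 1" using f_lower[of "1/2"] by simp
      also have "\<dots> \<le> f s * exp (a * s)"
        using 3 that f_mono[of s "1/2"] \<open>a > 0\<close> w unfolding f_def by (intro mult_mono) (auto intro!: sum_nonneg mult_nonneg_nonneg)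
      finally show ?thesis .
    qed
  qed
  show thesis
  proof (rule that[of L \<delta> w "q L * c"])
    show "\<delta> = ln (1 / \<theta>) / real (Suc L)" by (simp add: \<delta>_def T_def)
    fix t :: real assume "t \<le> 0"
    then show "q L * c \<le> w * (\<Sum>l=1..L. exp t ^ l) * exp (- (a / \<delta>) * t)"
      using main[of "- t / \<delta>"] \<delta> by (simp add: f_def divide_nonpos_pos)
  qed (use L \<delta> w in auto)
qed

text \<open>
  Block \<open>i\<close> consists of the labels in \<open>{block_end \<delta> i<..block_end \<delta> (Suc i)}\<close>.
\<close>
definition block_end :: "real \<Rightarrow> nat \<Rightarrow> nat" where
  "block_end \<delta> i = nat \<lfloor>exp (\<delta> * real i)\<rfloor>"

lemma block_end:
  "real (block_end \<delta> i) \<le> exp (\<delta> * real i)" "exp (\<delta> * real i) < real (block_end \<delta> i) + 1"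
  unfolding block_end_def by (auto intro: of_nat_floor)

lemma block_end_mono: "0 \<le> \<delta> \<Longrightarrow> i \<le> i' \<Longrightarrow> block_end \<delta> i \<le> block_end \<delta> i'"
  unfolding block_end_def by (intro nat_mono floor_mono) (simp add: mult_left_mono)

lemma block_end_pos: "0 \<le> \<delta> \<Longrightarrow> 1 \<le> block_end \<delta> i"
  using block_end_mono[of \<delta> 0 i] by (simp add: block_end_def)

lemma sum_card_blocks:
  assumes "0 \<le> \<delta>" "L \<le> i"
  shows "(\<Sum>l=1..L. card {v \<in> {block_end \<delta> (i - l)<..block_end \<delta> (Suc (i - l))}. Q v})
    = card {v \<in> {block_end \<delta> (i - L)<..block_end \<delta> i}. Q v}"
  using assms(2)
proof (induction L)
  case (Suc L)
  let ?B = "block_end \<delta>"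
  have le: "?B (i - Suc L) \<le> ?B (i - L)" "?B (i - L) \<le> ?B i" using assms by (auto intro: block_end_mono)
  have "{v \<in> {?B (i - Suc L)<..?B i}. Q v} = {v \<in> {?B (i - Suc L)<..?B (i - L)}. Q v} \<union> {v \<in> {?B (i - L)<..?B i}. Q v}"
    using le by auto
  then have "card {v \<in> {?B (i - Suc L)<..?B i}. Q v}
      = card {v \<in> {?B (i - Suc L)<..?B (i - L)}. Q v} + card {v \<in> {?B (i - L)<..?B i}. Q v}"
    by (rule trans[OF arg_cong[of _ _ card] card_Un_disjoint]) auto
  then show ?case using Suc by (simp add: Suc_diff_Suc)
qed simp

text \<open>
  The sum is the expected number of children in block \<open>i\<close> of a vertex that is visible during the whole
  block. The block has about \<open>(exp \<delta> - 1) * exp (\<delta> * i)\<close> vertices and the windows have at most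
  about \<open>(1 - \<theta>) * exp (\<delta> * (i + 1))\<close> elements.
\<close>
lemma block_rate:
  assumes \<theta>: "0 < \<theta>" "\<theta> < 1" and \<delta>: "0 < \<delta>" and w: "w < (1 - exp (- \<delta>)) / (1 - \<theta>)"
  shows "eventually (\<lambda>i. w \<le> (\<Sum>n\<in>{block_end \<delta> i..<block_end \<delta> (Suc i)}.
    1 / real (card (memory_window (macro_j \<theta>) n)))) sequentially"
proof -
  define f where "f x = ((exp \<delta> - 1) * x - 1) / ((1 - \<theta>) * exp \<delta> * x + 2)" for x
  have "(f \<longlongrightarrow> (exp \<delta> - 1) * (inverse (1 - \<theta>) * inverse (exp \<delta>))) at_top"
    unfolding f_def using \<theta> by real_asymp
  also have "(exp \<delta> - 1) * (inverse (1 - \<theta>) * inverse (exp \<delta>)) = (1 - exp (- \<delta>)) / (1 - \<theta>)"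
    by (simp add: exp_minus divide_inverse algebra_simps)
  finally have "(f \<longlongrightarrow> (1 - exp (- \<delta>)) / (1 - \<theta>)) at_top" .
  moreover have "filterlim (\<lambda>i. exp (\<delta> * real i)) at_top sequentially" using \<delta> by real_asymp
  ultimately have "(\<lambda>i. f (exp (\<delta> * real i))) \<longlonglongrightarrow> (1 - exp (- \<delta>)) / (1 - \<theta>)"
    by (rule filterlim_compose)
  then have "eventually (\<lambda>i. w < f (exp (\<delta> * real i))) sequentially" using w by (rule order_tendstoD)
  then show ?thesis
  proof eventually_elim
    case (elim i)
    let ?b = "block_end \<delta> i" and ?b' = "block_end \<delta> (Suc i)"
    define C where "C = (1 - \<theta>) * exp \<delta> * exp (\<delta> * real i) + 2"
    have "C > 0" using \<theta> by (simp add: C_def add_pos_pos)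
    have "(exp \<delta> - 1) * exp (\<delta> * real i) - 1 \<le> real (?b' - ?b)"
    proof -
      have "?b \<le> ?b'" using \<delta> by (intro block_end_mono) auto
      then have "real (?b' - ?b) = real ?b' - real ?b" by (rule of_nat_diff)
      moreover have "(exp \<delta> - 1) * exp (\<delta> * real i) = exp (\<delta> * real (Suc i)) - exp (\<delta> * real i)"
        by (simp add: left_diff_distrib mult_exp_exp distrib_left)
      ultimately show ?thesis using block_end[of \<delta> i] block_end[of \<delta> "Suc i"] by linarith
    qed
    then have "f (exp (\<delta> * real i)) \<le> real (?b' - ?b) / C"
      unfolding f_def C_def[symmetric] using \<open>C > 0\<close> by (intro divide_right_mono) auto
    also have "\<dots> = (\<Sum>n\<in>{?b..<?b'}. 1 / C)" by simp
    also have "\<dots> \<le> (\<Sum>n\<in>{?b..<?b'}. 1 / real (card (memory_window (macro_j \<theta>) n)))"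
    proof (rule sum_mono)
      fix n assume n: "n \<in> {?b..<?b'}"
      have "1 \<le> n" using n block_end_pos[of \<delta> i] \<delta> by auto
      have "real n \<le> exp \<delta> * exp (\<delta> * real i)"
        using n block_end(1)[of \<delta> "Suc i"] by (simp add: algebra_simps exp_add)
      then have "(1 - \<theta>) * real n + 2 \<le> C" using \<theta> by (simp add: C_def mult.assoc)
      then have "real (card (memory_window (macro_j \<theta>) n)) \<le> C"
        using card_memory_window_macro_le[OF \<theta> \<open>1 \<le> n\<close>] by simp
      moreover have "0 < card (memory_window (macro_j \<theta>) n)"
        using memory_window_macro_nonempty[OF \<theta> \<open>1 \<le> n\<close>] by (auto simp: memory_window_def card_gt_0_iff)
      ultimately show "1 / C \<le> 1 / real (card (memory_window (macro_j \<theta>) n))"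
        by (intro divide_left_mono) auto
    qed
    finally show ?case using elim by simp
  qed
qed

text \<open>
  Since \<open>\<theta> = exp (- \<delta> * (L + 1))\<close>, the window of the last vertex of block \<open>i\<close> reaches back to the
  beginning of block \<open>i - L\<close>.
\<close>
lemma blocks_in_window:
  assumes \<theta>: "0 < \<theta>" "\<theta> < 1" and \<delta>: "\<delta> = ln (1 / \<theta>) / real (Suc L)" and i: "L \<le> i"
    and n: "block_end \<delta> i \<le> n" "n < block_end \<delta> (Suc i)"
  shows "{block_end \<delta> (i - L)<..block_end \<delta> i} \<subseteq> memory_window (macro_j \<theta>) n"
proof
  fix u assume u: "u \<in> {block_end \<delta> (i - L)<..block_end \<delta> i}"
  have "\<delta> * real (Suc L) = - ln \<theta>" using \<theta> by (simp add: \<delta> ln_div)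
  then have \<theta>_eq: "exp (- (\<delta> * real (Suc L))) = \<theta>" using \<theta> by simp
  have "real n \<le> exp (\<delta> * real (Suc i))" using n block_end(1)[of \<delta> "Suc i"] by linarith
  then have "\<theta> * real n \<le> exp (- (\<delta> * real (Suc L))) * exp (\<delta> * real (Suc i))"
    unfolding \<theta>_eq using \<theta> by (intro mult_left_mono) auto
  also have "\<dots> = exp (\<delta> * real (i - L))"
    unfolding mult_exp_exp using i by (intro arg_cong[of _ _ exp]) (simp add: of_nat_diff algebra_simps)
  also have "\<dots> < real (block_end \<delta> (i - L)) + 1" by (rule block_end)
  also have "\<dots> \<le> real u" using u by simp
  finally have "macro_j \<theta> n \<le> u" by (simp add: macro_j_def nat_le_iff floor_le_iff)
  then show "u \<in> memory_window (macro_j \<theta>) n" using u n by (auto simp: memory_window_def)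
qed

text \<open>
  The derivative of \<open>(1 + \<eta>) * (1 - exp (- t)) - t\<close> at \<open>t = 0\<close> is \<open>\<eta> > 0\<close>.
\<close>
lemma exists_chernoff_parameter:
  fixes \<eta> :: real
  assumes "0 < \<eta>"
  obtains t where "0 < t" "0 < (1 + \<eta>) * (1 - exp (- t)) - t"
proof -
  define t where "t = \<eta> / 2"
  have t: "0 < t" "t < \<eta>" using assms by (auto simp: t_def)
  have "exp (- t) \<le> 1 / (1 + t)"
    using exp_ge_add_one_self[of t] t unfolding exp_minus inverse_eq_divide by (intro divide_left_mono) auto
  also have "1 / (1 + t) = 1 - t / (1 + t)" using t by (simp add: divide_simps)
  finally have "t / (1 + t) \<le> 1 - exp (- t)" by linarith
  then have "(1 + \<eta>) * (t / (1 + t)) \<le> (1 + \<eta>) * (1 - exp (- t))" using assms by (intro mult_left_mono) auto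
  moreover have "1 < (1 + \<eta>) / (1 + t)" using t by simp
  then have "t * 1 < t * ((1 + \<eta>) / (1 + t))" using t(1) by (rule mult_strict_left_mono)
  then have "t < (1 + \<eta>) * (t / (1 + t))" by (simp add: mult.commute)
  ultimately have "0 < (1 + \<eta>) * (1 - exp (- t)) - t" by linarith
  with t that show thesis by blast
qed

section \<open>Labels of deep vertices: block growth\<close>

context limited_memory_choices
begin

text \<open>
  Chernoff bound for the lower tail of a sum of independent indicators, whose mean exceeds \<open>x\<close> by the factor
  \<open>1 + \<eta>\<close>.
\<close>
lemma prob_few_choices:
  assumes J: "finite J" "J \<subseteq> {1..}" and t: "0 \<le> t" and \<eta>: "0 \<le> \<eta>"
    and x: "(1 + \<eta>) * x \<le> (\<Sum>n\<in>J. prob {\<omega> \<in> space M. V n \<omega> \<in> S})"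
  shows "prob {\<omega> \<in> space M. real (card {n \<in> J. V n \<omega> \<in> S}) < x} \<le> exp (- x * ((1 + \<eta>) * (1 - exp (- t)) - t))"
proof -
  define Y where "Y n \<omega> = exp (- t * indicator S (V n \<omega>))" for n \<omega>
  let ?p = "\<lambda>n. prob {\<omega> \<in> space M. V n \<omega> \<in> S}"
  have ind: "indep_vars (\<lambda>_. borel) Y J"
    unfolding Y_def
    by (rule indep_vars_compose2[OF indep_vars_subset[OF indep_choices J(2)]]) auto
  have Y_eq: "Y n \<omega> = 1 - (1 - exp (- t)) * indicator S (V n \<omega>)" for n \<omega>
    by (simp add: Y_def indicator_def)
  have V_S: "{\<omega> \<in> space M. V n \<omega> \<in> S} \<in> events" if "n \<in> J" for n
    using that J measurable_sets[OF measurable_V, of n S] by (auto simp: vimage_def Int_def conj_commute)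
  have ind_S: "integrable M (\<lambda>\<omega>. indicator S (V n \<omega>) :: real)" 
    "expectation (\<lambda>\<omega>. indicator S (V n \<omega>) :: real) = ?p n" if "n \<in> J" for n
  proof -
    have eq: "indicator S (V n \<omega>) = (indicator {\<omega> \<in> space M. V n \<omega> \<in> S} \<omega> :: real)" if "\<omega> \<in> space M" for \<omega>
      using that by (simp add: indicator_def)
    show "integrable M (\<lambda>\<omega>. indicator S (V n \<omega>) :: real)"
      using V_S[OF that] by (subst Bochner_Integration.integrable_cong[OF refl eq]) (auto simp: emeasure_eq_measure)
    show "expectation (\<lambda>\<omega>. indicator S (V n \<omega>) :: real) = ?p n"
      using V_S[OF that] by (subst Bochner_Integration.integral_cong[OF refl eq]) (auto simp: Int_absorb1)
  qed
  have int: "integrable M (Y n)" if "n \<in> J" for n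
    unfolding Y_eq[abs_def] using ind_S that by auto
  have EY: "expectation (Y n) \<le> exp (- (1 - exp (- t)) * ?p n)" if "n \<in> J" for n
  proof -
    have "expectation (Y n) = 1 - (1 - exp (- t)) * ?p n"
      unfolding Y_eq[abs_def] using ind_S that by (simp add: prob_space)
    then show ?thesis using exp_ge_add_one_self[of "- (1 - exp (- t)) * ?p n"] by (simp add: algebra_simps)
  qed
  have prodY: "(\<Prod>n\<in>J. Y n \<omega>) = exp (- t * real (card {n \<in> J. V n \<omega> \<in> S}))" for \<omega>
  proof -
    have "real (card {n \<in> J. V n \<omega> \<in> S}) = (\<Sum>n\<in>J. indicator S (V n \<omega>))"
      using J(1) by (simp add: indicator_def sum.If_cases Int_def)
    then show ?thesis
      by (simp add: Y_def exp_sum[OF J(1), symmetric] sum_distrib_left sum_negf)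
  qed
  have intP: "integrable M (\<lambda>\<omega>. \<Prod>n\<in>J. Y n \<omega>)" by (rule indep_vars_integrable[OF J(1) ind int])
  have "prob {\<omega> \<in> space M. real (card {n \<in> J. V n \<omega> \<in> S}) < x} \<le> prob {\<omega> \<in> space M. exp (- t * x) \<le> (\<Prod>n\<in>J. Y n \<omega>)}"
  proof (rule finite_measure_mono)
    show "{\<omega> \<in> space M. real (card {n \<in> J. V n \<omega> \<in> S}) < x} \<subseteq> {\<omega> \<in> space M. exp (- t * x) \<le> (\<Prod>n\<in>J. Y n \<omega>)}"
      using t by (auto simp: prodY intro: mult_left_mono)
    have [measurable]: "(\<lambda>\<omega>. \<Prod>n\<in>J. Y n \<omega>) \<in> borel_measurable M" using intP by (rule borel_measurable_integrable)
    show "{\<omega> \<in> space M. exp (- t * x) \<le> (\<Prod>n\<in>J. Y n \<omega>)} \<in> events" by measurable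
  qed
  also have "\<dots> \<le> expectation (\<lambda>\<omega>. \<Prod>n\<in>J. Y n \<omega>) / exp (- t * x)"
    by (rule integral_Markov_inequality_measure[OF intP]) (auto simp: Y_def intro!: prod_nonneg)
  also have "expectation (\<lambda>\<omega>. \<Prod>n\<in>J. Y n \<omega>) = (\<Prod>n\<in>J. expectation (Y n))"
    by (rule indep_vars_lebesgue_integral[OF J(1) ind int])
  also have "\<dots> \<le> (\<Prod>n\<in>J. exp (- (1 - exp (- t)) * ?p n))"
    using EY by (intro prod_mono) (auto simp: Y_def)
  also have "\<dots> = exp (- (1 - exp (- t)) * (\<Sum>n\<in>J. ?p n))"
    using J(1) by (simp add: exp_sum sum_distrib_left sum_negf)
  also have "\<dots> \<le> exp (- (1 - exp (- t)) * ((1 + \<eta>) * x))"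
    using mult_left_mono[OF x, of "1 - exp (- t)"] t by (simp only: exp_le_cancel_iff mult_minus_left neg_le_iff_le) simp
  finally show ?thesis by (simp add: divide_right_mono algebra_simps flip: exp_diff exp_add)
qed

text \<open>
  The set \<open>F \<omega>\<close> of possible parents depends on the choices before time \<open>b\<close>, and the choices made from
  \<open>b\<close> on are independent of it. So the Chernoff bound applies conditionally on each value \<open>S\<close> of \<open>F\<close>; only
  values with \<open>y \<le> w * card S\<close> occur in the event, and they share the bound \<open>exp (- c * y)\<close>.
\<close>
lemma prob_few_children:
  fixes k :: nat
  assumes b: "1 \<le> b" and A: "A \<subseteq> {1..b}" and t: "0 \<le> t" and \<eta>: "0 \<le> \<eta>"
    and sub: "\<And>n. b \<le> n \<Longrightarrow> n < b' \<Longrightarrow> A \<subseteq> memory_window j n"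
    and ne: "\<And>n. n \<ge> 1 \<Longrightarrow> memory_window j n \<noteq> {}"
    and rate: "(1 + \<eta>) * w \<le> (\<Sum>n\<in>{b..<b'}. 1 / real (card (memory_window j n)))"
    and c: "c = (1 + \<eta>) * (1 - exp (- t)) - t" "0 \<le> c"
  defines "F \<equiv> \<lambda>\<omega>. {u \<in> A. k \<le> depth \<omega> u}"
  shows "{\<omega> \<in> space M. y \<le> w * card (F \<omega>) \<and> real (card {v \<in> {b<..b'}. Suc k \<le> depth \<omega> v}) < w * card (F \<omega>)} \<in> events"
      (is "?bad \<in> _")
    and "prob {\<omega> \<in> space M. y \<le> w * card (F \<omega>) \<and> real (card {v \<in> {b<..b'}. Suc k \<le> depth \<omega> v}) < w * card (F \<omega>)}
      \<le> exp (- c * y)"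
proof -
  have finA: "finite A" using A by (rule finite_subset) simp
  let ?J = "{b..<b'}"
  have J: "finite ?J" "?J \<subseteq> {1..}" using b by auto
  have dep: "{u \<in> A. k \<le> lm_depth f u} = {u \<in> A. k \<le> lm_depth g u}"
    if "\<And>n. n \<in> {1..<b} \<Longrightarrow> f n = g n" for f g
    using that A by (intro Collect_cong conj_cong refl arg_cong2[of _ _ _ _ "(\<le>)"] lm_depth_cong) auto
  have dep': "{v \<in> {b<..b'}. Suc k \<le> lm_depth f v} = {v \<in> {b<..b'}. Suc k \<le> lm_depth g v}"
    "{u \<in> A. k \<le> lm_depth f u} = {u \<in> A. k \<le> lm_depth g u}"
    if "\<And>n. n \<in> {1..<max b b'} \<Longrightarrow> f n = g n" for f g
    using that A by (auto intro!: Collect_cong conj_cong arg_cong2[of _ _ _ _ "(\<le>)"] lm_depth_cong)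
  show bad: "?bad \<in> events"
    unfolding F_def
  proof (rule events_choices[of "{1..<max b b'}" "\<lambda>f. y \<le> w * card {u \<in> A. k \<le> lm_depth f u} \<and>
        real (card {v \<in> {b<..b'}. Suc k \<le> lm_depth f v}) < w * card {u \<in> A. k \<le> lm_depth f u}"])
    fix f g :: "nat \<Rightarrow> nat" assume eq: "\<And>n. n \<in> {1..<max b b'} \<Longrightarrow> f n = g n"
    show "(y \<le> w * card {u \<in> A. k \<le> lm_depth f u} \<and>
        real (card {v \<in> {b<..b'}. Suc k \<le> lm_depth f v}) < w * card {u \<in> A. k \<le> lm_depth f u}) =
      (y \<le> w * card {u \<in> A. k \<le> lm_depth g u} \<and>
        real (card {v \<in> {b<..b'}. Suc k \<le> lm_depth g v}) < w * card {u \<in> A. k \<le> lm_depth g u})"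
      by (simp only: dep'[of f g, OF eq])
  qed auto
  have dep_eq: "({u \<in> A. k \<le> lm_depth f u} = S) = ({u \<in> A. k \<le> lm_depth g u} = S)"
    if "\<And>n. n \<in> {1..<b} \<Longrightarrow> f n = g n" for f g S
    by (simp only: dep[of f g, OF that])
  have dep_J: "(real (card {n \<in> ?J. f n \<in> S}) < w * card S) = (real (card {n \<in> ?J. g n \<in> S}) < w * card S)"
    if "\<And>n. n \<in> ?J \<Longrightarrow> f n = g n" for f g :: "nat \<Rightarrow> nat" and S
  proof -
    have "{n \<in> ?J. f n \<in> S} = {n \<in> ?J. g n \<in> S}" by (intro Collect_cong conj_cong refl) (simp only: that)
    then show ?thesis by (simp only:)
  qed
  define E where "E S = {\<omega> \<in> space M. F \<omega> = S}" for S
  define G where "G S = {\<omega> \<in> space M. real (card {n \<in> ?J. V n \<omega> \<in> S}) < w * card S}" for S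
  let ?T = "{S \<in> Pow A. y \<le> w * card S}"
  have E: "E S \<in> events" for S
    unfolding E_def F_def
    by (rule events_choices[of "{1..<b}" "\<lambda>f. {u \<in> A. k \<le> lm_depth f u} = S"]) (rule dep_eq, blast | simp | force)+
  have G: "G S \<in> events" for S
    unfolding G_def
    by (rule events_choices[OF J, of "\<lambda>f. real (card {n \<in> ?J. f n \<in> S}) < w * card S"]) (rule dep_J, blast)
  have EG: "prob (E S \<inter> G S) = prob (E S) * prob (G S)" for S
  proof -
    have "prob {\<omega> \<in> space M. F \<omega> = S \<and> real (card {n \<in> ?J. V n \<omega> \<in> S}) < w * card S} = prob (E S) * prob (G S)"
      unfolding E_def F_def G_def
      by (rule indep_events_choices[of "{1..<b}" "\<lambda>f. {u \<in> A. k \<le> lm_depth f u} = S" ?J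
            "\<lambda>f. real (card {n \<in> ?J. f n \<in> S}) < w * card S"])
        (rule dep_eq, blast | rule dep_J, blast | simp | use b in force)+
    moreover have "E S \<inter> G S = {\<omega> \<in> space M. F \<omega> = S \<and> real (card {n \<in> ?J. V n \<omega> \<in> S}) < w * card S}"
      by (auto simp: E_def G_def)
    ultimately show ?thesis by simp
  qed
  have children: "card {n \<in> ?J. V n \<omega> \<in> F \<omega>} \<le> card {v \<in> {b<..b'}. Suc k \<le> depth \<omega> v}" for \<omega>
  proof (rule card_inj_on_le[of Suc])
    show "Suc ` {n \<in> ?J. V n \<omega> \<in> F \<omega>} \<subseteq> {v \<in> {b<..b'}. Suc k \<le> depth \<omega> v}"
      using A by (force simp: F_def)
  qed auto
  have GS: "prob (G S) \<le> exp (- c * y)" if S: "S \<in> ?T" for S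
  proof -
    have "prob (G S) \<le> exp (- (w * card S) * ((1 + \<eta>) * (1 - exp (- t)) - t))"
      unfolding G_def
    proof (rule prob_few_choices[OF J t \<eta>])
      have "(1 + \<eta>) * (w * card S) \<le> (\<Sum>n\<in>?J. 1 / real (card (memory_window j n))) * card S"
        using mult_right_mono[OF rate, of "card S"] by (simp add: mult_ac)
      also have "\<dots> = (\<Sum>n\<in>?J. prob {\<omega> \<in> space M. V n \<omega> \<in> S})"
        unfolding sum_distrib_right
      proof (rule sum.cong)
        fix n assume n: "n \<in> ?J"
        then have "memory_window j n \<inter> S = S" using sub[of n] S by auto
        then show "1 / real (card (memory_window j n)) * card S = prob {\<omega> \<in> space M. V n \<omega> \<in> S}"
          using n b ne[of n] by (subst prob_choice) auto
      qed simp
      finally show "(1 + \<eta>) * (w * card S) \<le> (\<Sum>n\<in>?J. prob {\<omega> \<in> space M. V n \<omega> \<in> S})" .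
    qed
    also have "\<dots> = exp (- (c * (w * card S)))" by (simp add: c(1) mult.commute)
    also have "\<dots> \<le> exp (- c * y)" using S c(2) by (simp add: mult_left_mono)
    finally show ?thesis .
  qed
  have "?bad \<subseteq> (\<Union>S\<in>?T. E S \<inter> G S)"
  proof
    fix \<omega> assume "\<omega> \<in> ?bad"
    then show "\<omega> \<in> (\<Union>S\<in>?T. E S \<inter> G S)"
      using children[of \<omega>] by (intro UN_I[of "F \<omega>"]) (auto simp: E_def G_def F_def)
  qed
  then have "prob ?bad \<le> prob (\<Union>S\<in>?T. E S \<inter> G S)"
    using E G finA by (intro finite_measure_mono) auto
  also have "\<dots> \<le> (\<Sum>S\<in>?T. prob (E S \<inter> G S))"
    using E G finA by (intro finite_measure_subadditive_finite) auto
  also have "\<dots> \<le> (\<Sum>S\<in>?T. prob (E S) * exp (- c * y))"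
    unfolding EG using GS by (intro sum_mono mult_left_mono) auto
  also have "\<dots> = prob (\<Union>S\<in>?T. E S) * exp (- c * y)"
    using E finA by (subst finite_measure_finite_Union) (auto simp: sum_distrib_right disjoint_family_on_def E_def)
  also have "\<dots> \<le> 1 * exp (- c * y)" by (intro mult_right_mono) auto
  finally show "prob ?bad \<le> exp (- c * y)" by simp
qed

text \<open>
  With \<open>y = i\<close> in the previous bound, the failure probabilities of the pairs \<open>k \<le> i\<close> are summable.
\<close>
lemma AE_block_growth:
  assumes \<theta>: "0 < \<theta>" "\<theta> < 1" and j: "j = macro_j \<theta>"
    and \<delta>: "\<delta> = ln (1 / \<theta>) / real (Suc L)" and w: "0 < w" "w < (1 - exp (- \<delta>)) / (1 - \<theta>)"
  shows "AE \<omega> in M. \<forall>\<^sub>F i in sequentially. \<forall>k\<le>i.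
    real i \<le> w * card {u \<in> {block_end \<delta> (i - L)<..block_end \<delta> i}. k \<le> depth \<omega> u} \<longrightarrow>
    w * card {u \<in> {block_end \<delta> (i - L)<..block_end \<delta> i}. k \<le> depth \<omega> u}
      \<le> card {v \<in> {block_end \<delta> i<..block_end \<delta> (Suc i)}. Suc k \<le> depth \<omega> v}"
proof -
  have "\<delta> > 0" using \<theta> by (simp add: \<delta>)
  define R where "R = (1 - exp (- \<delta>)) / (1 - \<theta>)"
  have "w < R" using w by (simp add: R_def)
  \<comment> \<open>With this \<open>\<eta>\<close>, \<open>(1 + \<eta>) * w\<close> is the midpoint between \<open>w\<close> and the limiting rate \<open>R\<close>.\<close>
  define \<eta> where "\<eta> = (R / w - 1) / 2"
  have \<eta>: "0 < \<eta>" using w \<open>w < R\<close> by (simp add: \<eta>_def)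
  have "(1 + \<eta>) * w = (R + w) / 2" using w by (simp add: \<eta>_def field_simps)
  also have "\<dots> < R" using \<open>w < R\<close> by simp
  finally have "(1 + \<eta>) * w < R" .
  then have w': "(1 + \<eta>) * w < (1 - exp (- \<delta>)) / (1 - \<theta>)" unfolding R_def .
  obtain t where t: "0 < t" "0 < (1 + \<eta>) * (1 - exp (- t)) - t" using exists_chernoff_parameter[OF \<eta>] .
  define c where "c = (1 + \<eta>) * (1 - exp (- t)) - t"
  have c: "0 < c" using t by (simp add: c_def)
  define F where "F i k \<omega> = w * real (card {u \<in> {block_end \<delta> (i - L)<..block_end \<delta> i}. k \<le> depth \<omega> u})" for i k \<omega>
  define G where "G i k \<omega> = real (card {v \<in> {block_end \<delta> i<..block_end \<delta> (Suc i)}. Suc k \<le> depth \<omega> v})" for i k \<omega>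
  define bad where "bad i k = {\<omega> \<in> space M. real i \<le> F i k \<omega> \<and> G i k \<omega> < F i k \<omega>}" for i k
  obtain i\<^sub>1 where i1: "\<And>i. i\<^sub>1 \<le> i \<Longrightarrow> L \<le> i \<and> (1 + \<eta>) * w \<le>
      (\<Sum>n\<in>{block_end \<delta> i..<block_end \<delta> (Suc i)}. 1 / real (card (memory_window (macro_j \<theta>) n)))"
    using eventually_conj[OF eventually_ge_at_top[of L] block_rate[OF \<theta> \<open>\<delta> > 0\<close> w']]
    by (auto simp: eventually_sequentially)
  have bad: "bad i k \<in> events" "prob (bad i k) \<le> exp (- c * i)" if i: "i\<^sub>1 \<le> i" for i k
  proof -
    let ?b = "block_end \<delta> i" and ?b' = "block_end \<delta> (Suc i)" and ?A = "{block_end \<delta> (i - L)<..block_end \<delta> i}"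
    have *: "1 \<le> ?b" "?A \<subseteq> {1..?b}" using \<open>\<delta> > 0\<close> block_end_pos[of \<delta> i] by auto
    have window: "?A \<subseteq> memory_window j n" if "?b \<le> n" "n < ?b'" for n
      unfolding j using i1[OF i] that by (intro blocks_in_window[OF \<theta> \<delta>]) simp_all
    have ne: "memory_window j n \<noteq> {}" if "n \<ge> 1" for n
      unfolding j using that by (rule memory_window_macro_nonempty[OF \<theta>])
    have rate: "(1 + \<eta>) * w \<le> (\<Sum>n\<in>{?b..<?b'}. 1 / real (card (memory_window j n)))"
      unfolding j using i1[OF i] by (rule conjunct2)
    note children = prob_few_children[OF * less_imp_le[OF t(1)] less_imp_le[OF \<eta>] window ne rate c_def less_imp_le[OF c]]
    show "bad i k \<in> events" unfolding bad_def F_def G_def by (rule children(1))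
    show "prob (bad i k) \<le> exp (- c * i)" unfolding bad_def F_def G_def by (rule children(2))
  qed
  define E where "E i = (if i\<^sub>1 \<le> i then (\<Union>k\<in>{..i}. bad i k) else {})" for i
  have E: "E i \<in> events" for i
    unfolding E_def by (cases "i\<^sub>1 \<le> i") (simp_all only: if_True if_False sets.empty_sets sets.finite_UN bad(1) finite_atMost)
  have E_bound: "prob (E i) \<le> (real i + 1) * exp (- c * i)" for i
  proof (cases "i\<^sub>1 \<le> i")
    case True
    have "prob (E i) = prob (\<Union>k\<in>{..i}. bad i k)" using True by (simp add: E_def)
    also have "\<dots> \<le> (\<Sum>k\<in>{..i}. prob (bad i k))"
      by (intro finite_measure_subadditive_finite image_subsetI bad(1) True finite_atMost)
    also have "\<dots> \<le> (\<Sum>k\<le>i. exp (- c * i))" by (intro sum_mono bad(2) True)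
    finally show ?thesis by (simp add: add.commute)
  qed (simp add: E_def)
  define d where "d = c / 2"
  have d: "0 < d" "c = d + d" using c by (simp_all add: d_def)
  have geometric: "prob (E i) \<le> exp d / d * exp (- d) ^ i" for i
  proof -
    have "d * (real i + 1) \<le> exp (d * (real i + 1))" using exp_ge_add_one_self[of "d * (real i + 1)"] by linarith
    then have "real i + 1 \<le> exp (d * (real i + 1)) / d" using d(1) by (simp add: le_divide_eq mult.commute)
    then have "(real i + 1) * exp (- c * i) \<le> exp (d * (real i + 1)) / d * exp (- c * i)"
      by (intro mult_right_mono) auto
    also have "\<dots> = exp (d * (real i + 1) + - c * i) / d" by (simp only: exp_add times_divide_eq_left)
    also have "d * (real i + 1) + - c * i = d + real i * (- d)" unfolding d(2) by (simp add: algebra_simps)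
    also have "exp (d + real i * (- d)) / d = exp d / d * exp (- d) ^ i"
      by (simp only: exp_add exp_of_nat_mult times_divide_eq_left)
    finally show ?thesis using E_bound[of i] by linarith
  qed
  have "summable (\<lambda>i. exp d / d * exp (- d) ^ i)" using d(1) by (intro summable_mult summable_geometric) simp
  then have "summable (\<lambda>i. prob (E i))"
    by (rule summable_comparison_test'[where N = 0]) (use geometric in simp)
  then have "AE \<omega> in M. eventually (\<lambda>i. \<omega> \<in> space M - E i) sequentially"
    using borel_cantelli_AE1[of E M, OF E] by (simp add: emeasure_eq_measure)
  then show ?thesis
  proof eventually_elim
    case (elim \<omega>)
    then show ?case using eventually_ge_at_top[of i\<^sub>1]
    proof eventually_elim
      case (elim i)
      show ?case
      proof (intro allI impI)
        fix k
        assume "k \<le> i" and large: "real i \<le> w * card {u \<in> {block_end \<delta> (i - L)<..block_end \<delta> i}. k \<le> depth \<omega> u}"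
        have "\<omega> \<in> space M" "\<omega> \<notin> bad i k" using elim \<open>k \<le> i\<close> by (auto simp only: E_def if_True)
        then have "\<not> G i k \<omega> < F i k \<omega>" using large unfolding bad_def F_def by blast
        then show "w * card {u \<in> {block_end \<delta> (i - L)<..block_end \<delta> i}. k \<le> depth \<omega> u}
            \<le> card {v \<in> {block_end \<delta> i<..block_end \<delta> (Suc i)}. Suc k \<le> depth \<omega> v}"
          unfolding F_def G_def by simp
      qed
    qed
  qed
qed

text \<open>
  The parameters are chosen at the intermediate value \<open>a\<^sub>0\<close> between \<open>\<kappa>\<close> and \<open>a\<close>, which leaves room for the
  degree \<open>m\<close> of the large coefficient: \<open>m\<close> blocks contribute \<open>\<delta> * m \<le> a * K\<close> to the logarithm of the label
  in \<open>K\<close> generations.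
\<close>
lemma AE_deep_vertices:
  assumes \<theta>: "0 < \<theta>" "\<theta> < 1" and j: "j = macro_j \<theta>" and a: "lm_kappa \<theta> < a"
  shows "AE \<omega> in M. \<exists>K b. 0 < K \<and> (\<forall>r. \<exists>v\<ge>1. real v \<le> exp (b + a * real (r * K)) \<and> r * K \<le> depth \<omega> v)"
proof -
  define a\<^sub>0 where "a\<^sub>0 = (lm_kappa \<theta> + a) / 2"
  have a0: "lm_kappa \<theta> < a\<^sub>0" "a\<^sub>0 < a" using a by (auto simp: a\<^sub>0_def)
  obtain L :: nat and \<delta> w \<rho> :: real where L: "1 \<le> L" and \<delta>: "\<delta> = ln (1 / \<theta>) / real (Suc L)" "0 < \<delta>" "\<delta> < a\<^sub>0"
    and w: "0 < w" "w < (1 - exp (- \<delta>)) / (1 - \<theta>)" and \<rho>: "1 < \<rho>"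
    "\<And>t. t \<le> 0 \<Longrightarrow> \<rho> \<le> w * (\<Sum>l=1..L. exp t ^ l) * exp (- (a\<^sub>0 / \<delta>) * t)"
    by (rule blocks_supercritical[OF \<theta> a0(1)]) blast
  define P where "P = (\<Sum>l=1..L. monom w l)"
  have coeff_P: "coeff P l = (if l \<in> {1..L} then w else 0)" for l
    by (simp add: P_def coeff_sum)
  have poly_P: "poly P x = w * (\<Sum>l=1..L. x ^ l)" for x
    by (simp add: P_def poly_sum poly_monom sum_distrib_left)
  have nn: "0 \<le> coeff P l" for l using w by (simp add: coeff_P)
  obtain K m where Km: "0 < K" "real m \<le> a / \<delta> * real K" "1 < coeff (P ^ K) m"
  proof (rule exists_coeff_power_gt_1[of P "a\<^sub>0 / \<delta>" "a / \<delta>" \<rho>])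
    show "0 < coeff P 1" using L w by (simp add: coeff_P)
    show "1 < a\<^sub>0 / \<delta>" "a\<^sub>0 / \<delta> < a / \<delta>" using \<delta>(2,3) a0 by (simp_all add: divide_strict_right_mono)
    show "\<rho> \<le> poly P (exp t) * exp (- (a\<^sub>0 / \<delta>) * t)" if "t \<le> 0" for t
      using \<rho>(2)[OF that] by (simp only: poly_P)
  qed (rule nn, rule \<rho>(1), rule that, assumption+)
  define N where "N \<omega> i k = real (card {v \<in> {block_end \<delta> i<..block_end \<delta> (Suc i)}. k \<le> depth \<omega> v})" for \<omega> i k
  \<comment> \<open>All vertices have depth at least \<open>0\<close>, so this is the exponential growth of the block sizes.\<close>
  have start: "filterlim (\<lambda>i. N \<omega> i 0 / real i) at_top sequentially" for \<omega>
  proof (rule filterlim_at_top_mono)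
    show "filterlim (\<lambda>i. ((exp \<delta> - 1) * exp (\<delta> * real i) - 1) / real i) at_top sequentially"
      using \<delta>(2) by real_asymp
    show "\<forall>\<^sub>F i in sequentially. ((exp \<delta> - 1) * exp (\<delta> * real i) - 1) / real i \<le> N \<omega> i 0 / real i"
    proof (intro always_eventually allI divide_right_mono)
      fix i
      have "block_end \<delta> i \<le> block_end \<delta> (Suc i)" using \<delta>(2) by (intro block_end_mono) auto
      moreover have "{v \<in> {block_end \<delta> i<..block_end \<delta> (Suc i)}. 0 \<le> depth \<omega> v} = {block_end \<delta> i<..block_end \<delta> (Suc i)}"
        by auto
      ultimately have "N \<omega> i 0 = real (block_end \<delta> (Suc i)) - real (block_end \<delta> i)"
        by (simp only: N_def card_greaterThanAtMost of_nat_diff)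
      moreover have "(exp \<delta> - 1) * exp (\<delta> * real i) = exp (\<delta> * real (Suc i)) - exp (\<delta> * real i)"
        by (simp add: left_diff_distrib mult_exp_exp distrib_left)
      ultimately show "(exp \<delta> - 1) * exp (\<delta> * real i) - 1 \<le> N \<omega> i 0"
        using block_end[of \<delta> i] block_end[of \<delta> "Suc i"] by linarith
    qed simp
  qed
  have parents: "(\<Sum>l\<le>i. coeff P l * N \<omega> (i - l) k)
      = w * real (card {u \<in> {block_end \<delta> (i - L)<..block_end \<delta> i}. k \<le> depth \<omega> u})" if "L \<le> i" for \<omega> i k
  proof -
    have "(\<Sum>l\<le>i. coeff P l * N \<omega> (i - l) k) = (\<Sum>l\<in>{1..L}. w * N \<omega> (i - l) k)"
      using that by (intro sum.mono_neutral_cong_right) (auto simp: coeff_P)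
    also have "\<dots> = w * real (\<Sum>l=1..L. card {v \<in> {block_end \<delta> (i - l)<..block_end \<delta> (Suc (i - l))}. k \<le> depth \<omega> v})"
      by (simp only: N_def sum_distrib_left of_nat_sum)
    also have "(\<Sum>l=1..L. card {v \<in> {block_end \<delta> (i - l)<..block_end \<delta> (Suc (i - l))}. k \<le> depth \<omega> v})
        = card {u \<in> {block_end \<delta> (i - L)<..block_end \<delta> i}. k \<le> depth \<omega> u}"
      using \<delta>(2) that by (intro sum_card_blocks) auto
    finally show ?thesis .
  qed
  show ?thesis
    using AE_block_growth[OF \<theta> j \<delta>(1) w]
  proof eventually_elim
    case (elim \<omega>)
    obtain i\<^sub>0 where i0: "\<And>i k. i\<^sub>0 \<le> i \<Longrightarrow> k \<le> i \<Longrightarrow>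
      real i \<le> w * card {u \<in> {block_end \<delta> (i - L)<..block_end \<delta> i}. k \<le> depth \<omega> u} \<Longrightarrow>
      w * card {u \<in> {block_end \<delta> (i - L)<..block_end \<delta> i}. k \<le> depth \<omega> u} \<le> N \<omega> i (Suc k)"
      using elim unfolding eventually_sequentially N_def by blast
    have "\<exists>I. \<forall>r. 0 < N \<omega> (I + r * m) (r * K)"
    proof (rule populations_never_empty[of P "N \<omega>" "max L i\<^sub>0"])
      fix i k assume ik: "max L i\<^sub>0 \<le> i" "k \<le> i" "real i \<le> (\<Sum>l\<le>i. coeff P l * N \<omega> (i - l) k)"
      then have "L \<le> i" "i\<^sub>0 \<le> i" by auto
      show "(\<Sum>l\<le>i. coeff P l * N \<omega> (i - l) k) \<le> N \<omega> i (Suc k)"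
        using i0[OF \<open>i\<^sub>0 \<le> i\<close> ik(2)] ik(3) unfolding parents[OF \<open>L \<le> i\<close>] .
    next
      show "coeff P 0 = 0" by (simp add: coeff_P)
      show "0 \<le> N \<omega> i k" for i k by (simp add: N_def)
    qed (fact nn start Km(3))+
    then obtain I where I: "\<And>r. 0 < N \<omega> (I + r * m) (r * K)" by blast
    have "\<exists>v\<ge>1. real v \<le> exp (\<delta> * real (Suc I) + a * real (r * K)) \<and> r * K \<le> depth \<omega> v" for r
    proof -
      have "{v \<in> {block_end \<delta> (I + r * m)<..block_end \<delta> (Suc (I + r * m))}. r * K \<le> depth \<omega> v} \<noteq> {}"
      proof
        assume "{v \<in> {block_end \<delta> (I + r * m)<..block_end \<delta> (Suc (I + r * m))}. r * K \<le> depth \<omega> v} = {}"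
        then have "N \<omega> (I + r * m) (r * K) = 0" by (simp only: N_def card.empty of_nat_0)
        with I[of r] show False by (simp only: less_irrefl)
      qed
      then obtain v where v: "block_end \<delta> (I + r * m) < v" "v \<le> block_end \<delta> (Suc (I + r * m))" "r * K \<le> depth \<omega> v"
        by auto
      have "real v \<le> exp (\<delta> * real (Suc (I + r * m)))"
        using v(2) block_end(1)[of \<delta> "Suc (I + r * m)"] by linarith
      also have "\<dots> \<le> exp (\<delta> * real (Suc I) + a * real (r * K))"
      proof -
        have "\<delta> * real m \<le> a * real K" using Km(2) \<delta>(2) by (simp add: field_simps)
        then have "real r * (\<delta> * real m) \<le> real r * (a * real K)" by (intro mult_left_mono) auto
        then show ?thesis by (simp add: algebra_simps)
      qed
      finally show ?thesis using v by (intro exI[of _ v]) auto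
    qed
    then show ?case using Km(1) by blast
  qed
qed

end

section \<open>Height asymptotics\<close>

text \<open>
  For \<open>k\<close> the least integer with \<open>n \<le> exp (a * k)\<close>, the maximum is less than \<open>k\<close>, hence at most
  \<open>ln n / a + 1\<close>.
\<close>
lemma eventually_Max_less:
  fixes d :: "nat \<Rightarrow> nat"
  assumes a: "0 < a" "1 / a < c"
    and d: "\<forall>\<^sub>F k in sequentially. \<forall>v\<ge>1. real v \<le> exp (a * real k) \<longrightarrow> d v < k"
  shows "\<forall>\<^sub>F n in sequentially. real (Max (d ` {1..n})) / ln (real n) < c"
proof -
  define k where "k n = nat \<lceil>ln (real n) / a\<rceil>" for n :: nat
  have k_lower: "ln (real n) / a \<le> real (k n)" for n unfolding k_def by (rule real_nat_ceiling_ge)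
  have "filterlim (\<lambda>n. ln (real n) / a) at_top sequentially" using a by real_asymp
  then have "filterlim (\<lambda>n. real (k n)) at_top sequentially"
    by (rule filterlim_at_top_mono) (use k_lower in simp)
  then have "filterlim k sequentially sequentially" by (simp add: filterlim_sequentially_iff_filterlim_real)
  then have ev: "\<forall>\<^sub>F n in sequentially. \<forall>v\<ge>1. real v \<le> exp (a * real (k n)) \<longrightarrow> d v < k n"
    using d by (rule eventually_compose_filterlim[rotated])
  have "(\<lambda>n. (ln (real n) / a + 1) / ln (real n)) \<longlonglongrightarrow> inverse a" using a by real_asymp
  then have "\<forall>\<^sub>F n in sequentially. (ln (real n) / a + 1) / ln (real n) < c"
    using a(2) unfolding inverse_eq_divide by (rule order_tendstoD)
  with ev eventually_gt_at_top[of 1] show ?thesis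
  proof eventually_elim
    case (elim n)
    have "0 < ln (real n)" using elim by simp
    have "\<forall>x\<in>d ` {1..n}. x < k n"
    proof safe
      fix v assume v: "v \<in> {1..n}"
      have "real v \<le> exp (ln (real n))" using v by simp
      also have "\<dots> \<le> exp (a * real (k n))" using k_lower[of n] a by (simp add: field_simps)
      finally show "d v < k n" using elim v by simp
    qed
    then have "Max (d ` {1..n}) < k n" using elim by (subst Max_less_iff) auto
    moreover have "0 < ln (real n) / a" using \<open>0 < ln (real n)\<close> a by simp
    then have "real (k n) < ln (real n) / a + 1" unfolding k_def by linarith
    ultimately have "real (Max (d ` {1..n})) \<le> ln (real n) / a + 1" by linarith
    then have "real (Max (d ` {1..n})) / ln (real n) \<le> (ln (real n) / a + 1) / ln (real n)"
      using \<open>0 < ln (real n)\<close> by (intro divide_right_mono) auto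
    with elim show ?case by linarith
  qed
qed

text \<open>
  For \<open>r\<close> the largest integer with \<open>exp (b + a * (r * K)) \<le> n\<close>, the maximum is at least \<open>r * K\<close>, hence at
  least \<open>(ln n - b) / a - K\<close>.
\<close>
lemma eventually_Max_greater:
  fixes d :: "nat \<Rightarrow> nat"
  assumes a: "0 < a" "c < 1 / a" and K: "0 < K"
    and d: "\<And>r. \<exists>v\<ge>1. real v \<le> exp (b + a * real (r * K)) \<and> r * K \<le> d v"
  shows "\<forall>\<^sub>F n in sequentially. c < real (Max (d ` {1..n})) / ln (real n)"
proof -
  have "(\<lambda>n. ((ln (real n) - b) / a - real K) / ln (real n)) \<longlonglongrightarrow> inverse a" using a by real_asymp
  then have "\<forall>\<^sub>F n in sequentially. c < ((ln (real n) - b) / a - real K) / ln (real n)"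
    using a(2) unfolding inverse_eq_divide by (rule order_tendstoD)
  moreover have "\<forall>\<^sub>F n in sequentially. b \<le> ln (real n)" by real_asymp
  ultimately show ?thesis using eventually_gt_at_top[of 1]
  proof eventually_elim
    case (elim n)
    define r where "r = nat \<lfloor>(ln (real n) - b) / (a * K)\<rfloor>"
    have x: "0 \<le> (ln (real n) - b) / (a * K)" using elim a by simp
    then have r: "real r \<le> (ln (real n) - b) / (a * K)" "(ln (real n) - b) / (a * K) - 1 \<le> real r"
      by (simp_all add: r_def)
    obtain v where v: "1 \<le> v" "real v \<le> exp (b + a * real (r * K))" "r * K \<le> d v" using d by blast
    have "real r * (a * K) \<le> ln (real n) - b" using r(1) a K by (simp add: pos_le_divide_eq)
    then have "a * real (r * K) \<le> ln (real n) - b" by (simp add: mult_ac)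
    then have "exp (b + a * real (r * K)) \<le> exp (ln (real n))" by simp
    then have "v \<le> n" using v elim by simp
    have "(ln (real n) - b) / a - real K = ((ln (real n) - b) / (a * K) - 1) * K"
      using a K by (simp add: field_simps)
    also have "\<dots> \<le> real (r * K)" using r(2) by (simp add: mult_right_mono)
    also have "\<dots> \<le> real (Max (d ` {1..n}))"
      using v \<open>v \<le> n\<close> by (intro of_nat_mono order_trans[OF v(3)] Max_ge) auto
    finally have "((ln (real n) - b) / a - real K) / ln (real n) \<le> real (Max (d ` {1..n})) / ln (real n)"
      using elim by (intro divide_right_mono) auto
    with elim show ?case by linarith
  qed
qed

theorem theorem2p6:
  fixes \<theta> :: real and M :: "'w measure" and V :: "nat \<Rightarrow> 'w \<Rightarrow> nat"
  assumes "0 < \<theta>" and "\<theta> < 1"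
    and "limited_memory_choices M (macro_j \<theta>) V"
  defines "H \<equiv> \<lambda>n \<omega>. tree_height 1 (with_proj (recursive_tree (\<lambda>k. V k \<omega>) n))"
  shows "AE \<omega> in M. (\<lambda>n. real (H n \<omega>) / ln (real n)) \<longlonglongrightarrow> 1 / lm_kappa \<theta>"
proof -
  interpret limited_memory_choices M "macro_j \<theta>" V by fact
  note \<theta> = \<open>0 < \<theta>\<close> \<open>\<theta> < 1\<close>
  define \<kappa> where "\<kappa> = lm_kappa \<theta>"
  have \<kappa>: "0 < \<kappa>" using lm_kappa_pos[OF \<theta>] by (simp add: \<kappa>_def)
  \<comment> \<open>Sequences tending to \<open>\<kappa>\<close> from below and from above reduce the limit to countably many null sets.\<close>
  define lo where "lo r = \<kappa> * (1 - 1 / real (r + 2))" for r :: nat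
  define hi where "hi r = \<kappa> * (1 + 1 / real (r + 1))" for r :: nat
  have lo: "0 < lo r" "lo r < \<kappa>" for r using \<kappa> by (auto simp: lo_def)
  have hi: "\<kappa> < hi r" for r using \<kappa> by (simp add: hi_def)
  have "(\<lambda>r. 1 / lo r) \<longlonglongrightarrow> inverse \<kappa>" "(\<lambda>r. 1 / hi r) \<longlonglongrightarrow> inverse \<kappa>"
    unfolding lo_def hi_def using \<kappa> by real_asymp+
  note lim = order_tendstoD(2)[OF this(1), unfolded inverse_eq_divide]
    order_tendstoD(1)[OF this(2), unfolded inverse_eq_divide]
  have "AE \<omega> in M. \<forall>n\<ge>1. V n \<omega> \<in> memory_window (macro_j \<theta>) n"
    by (rule AE_choice_in_window[OF memory_window_macro_nonempty[OF \<theta>]])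
  moreover have "AE \<omega> in M. \<forall>r. \<forall>\<^sub>F k in sequentially. \<forall>v\<ge>1. real v \<le> exp (lo r * real k) \<longrightarrow> depth \<omega> v < k"
    unfolding AE_all_countable using AE_shallow_vertices[OF \<theta> refl] lo by (simp add: \<kappa>_def)
  moreover have "AE \<omega> in M. \<forall>r. \<exists>K b. 0 < K \<and> (\<forall>q. \<exists>v\<ge>1. real v \<le> exp (b + hi r * real (q * K)) \<and> q * K \<le> depth \<omega> v)"
    unfolding AE_all_countable using AE_deep_vertices[OF \<theta> refl] hi by (simp only: \<kappa>_def) blast
  ultimately show ?thesis
  proof eventually_elim
    case (elim \<omega>)
    have "H n \<omega> = Max (depth \<omega> ` {1..n})" if "1 \<le> n" for n
      unfolding H_def using that elim(1) by (intro tree_height_recursive_tree) (auto simp: memory_window_def)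
    then have H: "\<forall>\<^sub>F n in sequentially. real (Max (depth \<omega> ` {1..n})) / ln (real n) = real (H n \<omega>) / ln (real n)"
      by (intro eventually_sequentiallyI[of 1]) simp
    have "(\<lambda>n. real (Max (depth \<omega> ` {1..n})) / ln (real n)) \<longlonglongrightarrow> 1 / \<kappa>"
    proof (rule order_tendstoI)
      fix c assume "c < 1 / \<kappa>"
      then obtain r where r: "c < 1 / hi r" using lim(2) by (auto simp: eventually_sequentially)
      obtain K b where "0 < K" "\<And>q. \<exists>v\<ge>1. real v \<le> exp (b + hi r * real (q * K)) \<and> q * K \<le> depth \<omega> v"
        using elim(3) by blast
      then show "\<forall>\<^sub>F n in sequentially. c < real (Max (depth \<omega> ` {1..n})) / ln (real n)"
        using r \<kappa> hi[of r] by (intro eventually_Max_greater[of "hi r"]) auto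
    next
      fix c assume "1 / \<kappa> < c"
      then obtain r where r: "1 / lo r < c" using lim(1) by (auto simp: eventually_sequentially)
      show "\<forall>\<^sub>F n in sequentially. real (Max (depth \<omega> ` {1..n})) / ln (real n) < c"
        by (rule eventually_Max_less[OF lo(1) r spec[OF elim(2)]])
    qed
    then show ?case unfolding \<kappa>_def using Lim_transform_eventually[OF _ H] by blast
  qed
qed

end
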